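(* Let $d \in \mathbb{N}$, $\delta \in (0,\infty)$, $T, L \in [0,\infty)$, $\Theta = \bigcup_{n=1}^{\infty} \mathbb{Z}^n$, $X \in C([0,T],\mathbb{R}^d)$, $\xi \in \mathbb{R}^d$, let $\|\cdot\| \colon \mathbb{R}^d \to [0,\infty)$ be a norm on $\mathbb{R}^d$, let $(S,\mathcal{S})$ be a measurable space, let $F \colon \mathbb{R}^d \times S \to \mathbb{R}^d$ be $(\mathcal{B}(\mathbb{R}^d)\otimes\mathcal{S})/\mathcal{B}(\mathbb{R}^d)$-measurable, and assume for all $x,y \in \mathbb{R}^d$, $s \in S$ that $\|F(x,s)-F(y,s)\| \le L\|x-y\|$. Let $(\Omega,\mathcal{F},\mathbb{P})$ be a probability space, let $Z^\theta \colon \Omega \to S$, $\theta \in \Theta$, be i.i.d. random variables, assume that $\mathbb{E}[\|F(\xi,Z^0)\|^2] < \infty$, and assume for all $t \in [0,T]$ that $$X(t) = \xi + \int_0^t \mathbb{E}[F(X(r),Z^0)]\,dr.$$ Let $\mathfrak{r}^\theta \colon \Omega \to [0,1]$, $\theta \in \Theta$, be independent random variables, each uniformly distributed on $[0,1]$, assume that $(\mathfrak{r}^\theta)_{\theta\in\Theta}$ and $(Z^\theta)_{\theta\in\Theta}$ are independent, and let $\mathcal{X}^\theta_{n,m} \colon [0,T]\times\Omega \to \mathbb{R}^d$, $n,m \in \mathbb{N}_0$, $\theta \in \Theta$, satisfy for all $n \in \mathbb{N}_0$, $m \in \mathbb{N}$, $\theta \in \Theta$, $t \in [0,T]$ that $$\mathcal{X}^\theta_{n,m}(t)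 = \Bigg[\sum_{l=1}^{n-1} \frac{t}{m^{n-l}} \sum_{k=1}^{m^{n-l}} \Big( F\big(\mathcal{X}^{(\theta,l,k)}_{l,m}(\mathfrak{r}^{(\theta,l,k)}t), Z^{(\theta,l,k)}\big) - F\big(\mathcal{X}^{(\theta,l,-k)}_{l-1,m}(\mathfrak{r}^{(\theta,l,k)}t), Z^{(\theta,l,k)}\big)\Big)\Bigg] + \Bigg[\frac{t\,\mathbf{1}_{\mathbb{N}}(n)}{m^n}\sum_{k=1}^{m^n} F\big(\xi,Z^{(\theta,0,k)}\big)\Bigg] + \xi.$$ For every $n,m \in \mathbb{N}$ let $RV_{n,m} \in \mathbb{N}$ be the number of realizations of the random variables $(Z^\theta)_{\theta\in\Theta}$ which are used to compute one realization of $\mathcal{X}^0_{n,m}(T)$; that is, with $RV_{0,m} = 0$ it holds for all $n,m\in\mathbb{N}$ that $RV_{n,m} \le m^n + \sum_{l=1}^{n-1}\big[m^{n-l}(1+RV_{l,m}+RV_{l-1,m})\big]$. Then there exist $c \in \mathbb{R}$ and $N = (N_\varepsilon)_{\varepsilon\in(0,1]} \colon (0,1] \to \mathbb{N}$ such that for all $\varepsilon \in (0,1]$ it holds that $RV_{N_\varepsilon,N_\varepsilon} \le c\,\varepsilon^{-(2+\delta)}$ and $\big(\mathbb{E}[\|X(T)-\mathcal{X}^0_{N_\varepsilon,N_\varepsilon}(T)\|^2]\big)^{1/2} \le \varepsilon$.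
   Context: $\mathbb{N}=\{1,2,3,\dots\}$ and $\mathbb{N}_0=\mathbb{N}\cup\{0\}$. $\mathbf{1}_{\mathbb{N}}(n)$ equals $1$ if $n\ge 1$ and $0$ if $n=0$; empty sums are $0$. The index $0$ in $Z^0$, $\mathcal{X}^0_{n,m}$ is the element $0\in\mathbb{Z}^1\subseteq\Theta$. For $\theta=(\theta_1,\dots,\theta_j)\in\mathbb{Z}^j$ and $l,k\in\mathbb{Z}$, $(\theta,l,k)$ denotes the concatenation $(\theta_1,\dots,\theta_j,l,k)\in\mathbb{Z}^{j+2}\subseteq\Theta$. $\mathcal{B}(\cdot)$ denotes the Borel sigma-algebra. The hypotheses guarantee that $\mathbb{E}[\|F(X(r),Z^0)\|]$ is finite and integrable in $r$, so the integral equation for $X$ is meaningful. *)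

theory Defs
  imports "HOL-Probability.Probability"
begin

definition is_norm :: "('a::real_vector \<Rightarrow> real) \<Rightarrow> bool" where
  "is_norm \<nu> \<longleftrightarrow>
     (\<forall>x. 0 \<le> \<nu> x) \<and>
     (\<forall>x. \<nu> x = 0 \<longleftrightarrow> x = 0) \<and>
     (\<forall>a x. \<nu> (a *\<^sub>R x) = \<bar>a\<bar> * \<nu> x) \<and>
     (\<forall>x y. \<nu> (x + y) \<le> \<nu> x + \<nu> y)"

(* The union of the sets Z^n, n >= 1: a tuple (th_1, ..., th_n) is the nonempty list
   [th_1, ..., th_n].  The index 0 is [0], and (th, l, k) is th @ [l, k]. *)
definition Theta :: "int list set" where
  "Theta = {\<theta>. \<theta> \<noteq> []}"

(* Independence of the families (A i), i in I, and (B j), j in J, each viewed as one random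
   variable with values in a product space.  The library's indep_var forces both random
   variables to have the same value type, so independence is stated for the generated
   sigma-algebras. *)
definition indep_families ::
  "'w measure \<Rightarrow> 'a measure \<Rightarrow> ('i \<Rightarrow> 'w \<Rightarrow> 'a) \<Rightarrow> 'i set \<Rightarrow>
   'b measure \<Rightarrow> ('j \<Rightarrow> 'w \<Rightarrow> 'b) \<Rightarrow> 'j set \<Rightarrow> bool" where
  "indep_families M Ma A I Mb B J \<longleftrightarrow>
     prob_space.indep_set M
       (sets (vimage_algebra (space M) (\<lambda>\<omega>. \<lambda>i\<in>I. A i \<omega>) (PiM I (\<lambda>_. Ma))))
       (sets (vimage_algebra (space M) (\<lambda>\<omega>. \<lambda>j\<in>J. B j \<omega>) (PiM J (\<lambda>_. Mb))))"

(* The indices of those Z that occur when the recursion for the approximation with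
   parameters n, m and index th is unfolded completely.  The theorem only uses the recursive
   bound on the number of realizations; RV_indices_card_le and RV_indices_card_pos below
   show that the actual number of these indices satisfies that bound. *)
function RV_indices :: "nat \<Rightarrow> nat \<Rightarrow> int list \<Rightarrow> int list set" where
  "RV_indices n m \<theta> =
     (if n = 0 then {} else (\<lambda>k. \<theta> @ [0, int k]) ` {1..m ^ n}) \<union>
     \<Union> ((\<lambda>l. \<Union> ((\<lambda>k. {\<theta> @ [int l, int k]}
          \<union> RV_indices l m (\<theta> @ [int l, int k])
          \<union> RV_indices (l - 1) m (\<theta> @ [int l, - int k])) ` {1..m ^ (n - l)})) ` {1..<n})"
  by pat_completeness auto
termination by (relation "Wellfounded.measure (\<lambda>(n, m, \<theta>). n)") auto

declare RV_indices.simps [simp del]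

lemma RV_indices_finite: "finite (RV_indices n m \<theta>)"
proof (induction n arbitrary: \<theta> rule: less_induct)
  case (less n)
  show ?case
    by (subst RV_indices.simps) (auto intro!: less.IH)
qed

lemma RV_indices_append: "RV_indices n m \<theta> = (\<lambda>\<eta>. \<theta> @ \<eta>) ` RV_indices n m []"
proof (induction n arbitrary: \<theta> rule: less_induct)
  case (less n)
  have IH: "RV_indices l m (\<theta> @ xs) = (\<lambda>\<eta>. \<theta> @ \<eta>) ` RV_indices l m xs"
    if "l < n" for l xs
    using less.IH[OF that, of "\<theta> @ xs"] less.IH[OF that, of xs]
    by (simp add: image_image)
  have IH': "RV_indices (l - Suc 0) m (\<theta> @ xs) = (\<lambda>\<eta>. \<theta> @ \<eta>) ` RV_indices (l - Suc 0) m xs"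
    if "l < n" for l xs
    using that by (intro IH) simp
  have "RV_indices n m \<theta> =
     (if n = 0 then {} else (\<lambda>k. \<theta> @ [0, int k]) ` {1..m ^ n}) \<union>
     (\<Union>l\<in>{1..<n}. \<Union>k\<in>{1..m ^ (n - l)}. {\<theta> @ [int l, int k]}
          \<union> (\<lambda>\<eta>. \<theta> @ \<eta>) ` RV_indices l m [int l, int k]
          \<union> (\<lambda>\<eta>. \<theta> @ \<eta>) ` RV_indices (l - 1) m [int l, - int k])"
    by (subst RV_indices.simps) (simp add: IH IH')
  also have "\<dots> = (\<lambda>\<eta>. \<theta> @ \<eta>) `
     ((if n = 0 then {} else (\<lambda>k. [0, int k]) ` {1..m ^ n}) \<union>
     (\<Union>l\<in>{1..<n}. \<Union>k\<in>{1..m ^ (n - l)}. {[int l, int k]}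
          \<union> RV_indices l m [int l, int k] \<union> RV_indices (l - 1) m [int l, - int k]))"
    by (simp add: image_Un image_UN image_image)
  also have "\<dots> = (\<lambda>\<eta>. \<theta> @ \<eta>) ` RV_indices n m []"
    by (simp add: RV_indices.simps[of n m "[]"])
  finally show ?case .
qed

lemma RV_indices_card: "card (RV_indices n m \<theta>) = card (RV_indices n m [0])"
proof -
  have "card (RV_indices n m xs) = card (RV_indices n m [])" for xs
    by (subst RV_indices_append) (simp add: card_image inj_on_def)
  then show ?thesis by metis
qed

lemma RV_indices_card_0: "card (RV_indices 0 m \<theta>) = 0"
  by (subst RV_indices.simps) simp

lemma RV_indices_card_pos:
  assumes "n > 0" "m > 0"
  shows "card (RV_indices n m \<theta>) > 0"
proof -
  have "\<theta> @ [0, 1] \<in> RV_indices n m \<theta>"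
    by (subst RV_indices.simps) (use assms in \<open>auto intro!: image_eqI[of _ _ 1]\<close>)
  then show ?thesis
    using RV_indices_finite card_gt_0_iff by blast
qed

lemma RV_indices_card_le:
  fixes n m :: nat
  defines "C \<equiv> \<lambda>n m. card (RV_indices n m [0])"
  shows "C n m \<le> m ^ n + (\<Sum>l\<in>{1..<n}. m ^ (n - l) * (1 + C l m + C (l - 1) m))"
proof -
  define B where "B l k = {[0] @ [int l, int k]} \<union> RV_indices l m ([0] @ [int l, int k])
      \<union> RV_indices (l - 1) m ([0] @ [int l, - int k])" for l k :: nat
  define A where
    "A = (if n = 0 then {} else (\<lambda>k::nat. [0] @ [0, int k]) ` {1..m ^ n})"
  have B: "card (B l k) \<le> 1 + C l m + C (l - 1) m" for l k
  proof -
    have "card (B l k) \<le> card {[0] @ [int l, int k]} + card (RV_indices l m ([0] @ [int l, int k]))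
      + card (RV_indices (l - 1) m ([0] @ [int l, - int k]))"
      unfolding B_def by (meson add_mono_thms_linordered_semiring(3) card_Un_le order_trans)
    also have "\<dots> = 1 + C l m + C (l - 1) m"
      unfolding C_def
      using RV_indices_card[of l m "[0] @ [int l, int k]"]
        RV_indices_card[of "l - 1" m "[0] @ [int l, - int k]"] by simp
    finally show ?thesis .
  qed
  have "card A \<le> card ((\<lambda>k::nat. [0] @ [0, int k]) ` {1..m ^ n})"
    by (auto simp: A_def intro: card_mono)
  also have "\<dots> \<le> m ^ n"
    using card_image_le[of "{1..m ^ n}" "\<lambda>k::nat. [0] @ [0, int k]"] by simp
  finally have A: "card A \<le> m ^ n" .
  have "C n m = card (A \<union> (\<Union>l\<in>{1..<n}. \<Union>k\<in>{1..m ^ (n - l)}. B l k))"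
    unfolding C_def A_def B_def by (subst RV_indices.simps) simp
  also have "\<dots> \<le> card A + card (\<Union>l\<in>{1..<n}. \<Union>k\<in>{1..m ^ (n - l)}. B l k)"
    by (rule card_Un_le)
  also have "card (\<Union>l\<in>{1..<n}. \<Union>k\<in>{1..m ^ (n - l)}. B l k)
      \<le> (\<Sum>l\<in>{1..<n}. card (\<Union>k\<in>{1..m ^ (n - l)}. B l k))"
    by (rule card_UN_le) simp
  also have "\<dots> \<le> (\<Sum>l\<in>{1..<n}. \<Sum>k\<in>{1..m ^ (n - l)}. card (B l k))"
    by (intro sum_mono card_UN_le) simp
  also have "\<dots> \<le> (\<Sum>l\<in>{1..<n}. \<Sum>k\<in>{1..m ^ (n - l)}. 1 + C l m + C (l - 1) m)"
    by (intro sum_mono B)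
  also have "\<dots> = (\<Sum>l\<in>{1..<n}. m ^ (n - l) * (1 + C l m + C (l - 1) m))"
    by simp
  finally show ?thesis using A by linarith
qed

end

theory Submission
  imports Defs "HOL-Real_Asymp.Real_Asymp"
begin

text \<open>
  All norms being equivalent, one may work with the Euclidean norm.  The pairs \<open>(Z\<^sup>\<theta>, r\<^sup>\<theta>)\<close> are
  i.i.d., so the approximations can be studied as functions on an infinite product space, where
  subfamilies with disjoint index sets are independent and passing to the family of descendants
  of an index preserves the measure.  The expectation of the multilevel sum telescopes, so that the
  mean square error splits into a bias, controlled by the error of level \<open>n - 1\<close> through the
  Lipschitz condition, and a sum of variances, controlled by the errors of all lower levels.
  By induction the mean square error of \<open>X\<^sub>n\<^sub>,\<^sub>m(t)\<close> is at most \<open>D 2\<^sup>n m\<^sup>-\<^sup>n exp (\<kappa> m t)\<close>, whereas the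
  cost is at most \<open>(5 m)\<^sup>n\<close>.  For \<open>n = m = N\<close> the error bound decays like \<open>(\<beta> / N)\<^sup>N\<close>, so taking the
  least \<open>N\<close> with error at most \<open>\<epsilon>\<close> costs only the factor \<open>\<epsilon>\<^sup>-\<^sup>\<delta>\<close> over the Monte Carlo rate \<open>\<epsilon>\<^sup>-\<^sup>2\<close>.
\<close>

section \<open>Second moments of independent sums\<close>

text \<open>The factor \<open>m\<close> in the exponent answers an obstacle. In the recursion for
  level \<open>n\<close>, the variance of level \<open>l\<close> is divided by
  \<open>m ^ (n - l)\<close> but involves the error of level \<open>l - 1\<close>, which is of order
  \<open>1 / m ^ (l - 1)\<close>; the bias involves the error of level \<open>n - 1\<close>. Both
  miss the target \<open>1 / m ^ n\<close> by one factor \<open>m\<close>. These errors are,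
  however, evaluated only at random times \<open>r * t\<close>, and \<open>t\<close> times the mean
  of \<open>exp (c * (r * t))\<close> over uniform \<open>r\<close> is
  \<open>(exp (c * t) - 1) / c\<close>. With \<open>c = \<kappa> * m\<close> this supplies the
  missing \<open>1 / m\<close>. The price \<open>exp (\<kappa> * m * T)\<close> is only exponential
  in \<open>N\<close> for \<open>m = N\<close>, so \<open>N ^ N\<close> outweighs it. The factor
  \<open>2 ^ n\<close> keeps the sum over the levels geometric.

  The approximations are given by nothing but their recursion, so their measurability and
  independence have to be derived: for each outcome the recursion is unfolded into
  \<open>mlp\<close>, a fixed function of the sample family.\<close>

lemma norm_square_eq_sum_Basis: "(norm (x :: 'b :: euclidean_space))\<^sup>2 = (\<Sum>b\<in>Basis. (x \<bullet> b)\<^sup>2)"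
  unfolding power2_norm_eq_inner by (subst euclidean_inner) (simp add: power2_eq_square)

context prob_space
begin

text \<open>By independence a new summand contributes the cross term
  \<open>2 * expectation (V i) * expectation ?S\<close>, which the new squared sum of means contains
  as well; only \<open>(expectation (V i))\<^sup>2\<close> is given away. The effect is variance
  plus squared mean with each variance relaxed to a raw second moment, so nothing has to be
  centred.\<close>

lemma indep_vars_sum_square_le:
  fixes V :: "'i \<Rightarrow> 'a \<Rightarrow> real"
  assumes "finite I" "indep_vars (\<lambda>_. borel) V I"
    and "\<And>i. i \<in> I \<Longrightarrow> integrable M (\<lambda>\<omega>. (V i \<omega>)\<^sup>2)"
  shows "integrable M (\<lambda>\<omega>. (\<Sum>i\<in>I. V i \<omega>)\<^sup>2) \<and>
    expectation (\<lambda>\<omega>. (\<Sum>i\<in>I. V i \<omega>)\<^sup>2)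
      \<le> (\<Sum>i\<in>I. expectation (\<lambda>\<omega>. (V i \<omega>)\<^sup>2)) + (\<Sum>i\<in>I. expectation (V i))\<^sup>2"
  using assms
proof (induction I rule: finite_induct)
  case empty
  then show ?case by simp
next
  case (insert i I)
  let ?S = "\<lambda>\<omega>. \<Sum>j\<in>I. V j \<omega>"
  have rv: "V j \<in> borel_measurable M" if "j \<in> insert i I" for j
    using insert.prems(1) that by (auto simp: indep_vars_def)
  have int: "integrable M (V j)" if "j \<in> insert i I" for j
    using square_integrable_imp_integrable[OF rv[OF that] insert.prems(2)[OF that]] .
  have IH: "integrable M (\<lambda>\<omega>. (?S \<omega>)\<^sup>2)"
    "expectation (\<lambda>\<omega>. (?S \<omega>)\<^sup>2)
      \<le> (\<Sum>j\<in>I. expectation (\<lambda>\<omega>. (V j \<omega>)\<^sup>2)) + (\<Sum>j\<in>I. expectation (V j))\<^sup>2"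
    using insert.IH insert.prems indep_vars_subset[OF insert.prems(1), of I] by auto
  have ind: "indep_var borel (V i) borel ?S"
    using indep_vars_sum[OF insert.hyps(1,2)] insert.prems(1) by simp
  have intS: "integrable M ?S" using int by auto
  have prod: "expectation (\<lambda>\<omega>. V i \<omega> * ?S \<omega>) = expectation (V i) * expectation ?S"
    "integrable M (\<lambda>\<omega>. V i \<omega> * ?S \<omega>)"
    using indep_var_lebesgue_integral[OF ind] indep_var_integrable[OF ind] int intS by auto
  have sq: "(\<Sum>j\<in>insert i I. V j \<omega>)\<^sup>2 = (V i \<omega>)\<^sup>2 + 2 * (V i \<omega> * ?S \<omega>) + (?S \<omega>)\<^sup>2" for \<omega>
    using insert.hyps by (simp add: power2_sum algebra_simps)
  have ES: "expectation ?S = (\<Sum>j\<in>I. expectation (V j))"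
    using int by (intro Bochner_Integration.integral_sum) auto
  have "expectation (\<lambda>\<omega>. (\<Sum>j\<in>insert i I. V j \<omega>)\<^sup>2) =
    expectation (\<lambda>\<omega>. (V i \<omega>)\<^sup>2) + 2 * (expectation (V i) * expectation ?S) + expectation (\<lambda>\<omega>. (?S \<omega>)\<^sup>2)"
    unfolding sq using insert.prems(2) IH(1) prod by simp
  also have "\<dots> \<le> (\<Sum>j\<in>insert i I. expectation (\<lambda>\<omega>. (V j \<omega>)\<^sup>2)) + (\<Sum>j\<in>insert i I. expectation (V j))\<^sup>2"
    using IH(2) insert.hyps zero_le_power2[of "expectation (V i)"]
    by (simp add: ES power2_sum) (simp add: algebra_simps add_increasing)
  finally have "expectation (\<lambda>\<omega>. (\<Sum>j\<in>insert i I. V j \<omega>)\<^sup>2) \<le>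
    (\<Sum>j\<in>insert i I. expectation (\<lambda>\<omega>. (V j \<omega>)\<^sup>2)) + (\<Sum>j\<in>insert i I. expectation (V j))\<^sup>2" .
  moreover have "integrable M (\<lambda>\<omega>. (\<Sum>j\<in>insert i I. V j \<omega>)\<^sup>2)"
    unfolding sq using insert.prems(2) IH(1) prod by simp
  ultimately show ?case by blast
qed

text \<open>The constant will be the deterministic part \<open>\<xi> - X t\<close> of the error, so
  that the last term becomes the squared bias.\<close>

lemma indep_vars_affine_square_le:
  fixes V :: "'i \<Rightarrow> 'a \<Rightarrow> real"
  assumes I: "finite I" "indep_vars (\<lambda>_. borel) V I"
    and V2: "\<And>i. i \<in> I \<Longrightarrow> integrable M (\<lambda>\<omega>. (V i \<omega>)\<^sup>2)"
  shows "integrable M (\<lambda>\<omega>. ((\<Sum>i\<in>I. V i \<omega>) + c)\<^sup>2)"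
    and "expectation (\<lambda>\<omega>. ((\<Sum>i\<in>I. V i \<omega>) + c)\<^sup>2)
      \<le> (\<Sum>i\<in>I. expectation (\<lambda>\<omega>. (V i \<omega>)\<^sup>2)) + ((\<Sum>i\<in>I. expectation (V i)) + c)\<^sup>2"
proof -
  let ?S = "\<lambda>\<omega>. \<Sum>i\<in>I. V i \<omega>"
  have int: "integrable M (V j)" if "j \<in> I" for j
    using square_integrable_imp_integrable[OF _ V2[OF that]] I(2) that by (auto simp: indep_vars_def)
  note S = indep_vars_sum_square_le[OF I V2]
  have intS: "integrable M ?S" using int by auto
  have ES: "expectation ?S = (\<Sum>j\<in>I. expectation (V j))"
    using int by (intro Bochner_Integration.integral_sum) auto
  have sq: "(?S \<omega> + c)\<^sup>2 = (?S \<omega>)\<^sup>2 + 2 * c * ?S \<omega> + c\<^sup>2" for \<omega>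
    by (simp add: power2_sum)
  show "integrable M (\<lambda>\<omega>. (?S \<omega> + c)\<^sup>2)"
    unfolding sq using S intS by (intro Bochner_Integration.integrable_add integrable_mult_right) auto
  have "expectation (\<lambda>\<omega>. (?S \<omega> + c)\<^sup>2) = expectation (\<lambda>\<omega>. (?S \<omega>)\<^sup>2) + 2 * c * expectation ?S + c\<^sup>2"
    unfolding sq using S intS
    by (subst Bochner_Integration.integral_add | intro Bochner_Integration.integrable_add integrable_mult_right | simp add: prob_space)+
  then show "expectation (\<lambda>\<omega>. (?S \<omega> + c)\<^sup>2)
      \<le> (\<Sum>i\<in>I. expectation (\<lambda>\<omega>. (V i \<omega>)\<^sup>2)) + ((\<Sum>i\<in>I. expectation (V i)) + c)\<^sup>2"
    using S by (simp add: ES power2_sum)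
qed

text \<open>Independence passes to each coordinate, and squared Euclidean norms are sums over
  coordinates, so the scalar bound adds up without a dimensional constant.\<close>

lemma indep_vars_norm_affine_square_le:
  fixes V :: "'i \<Rightarrow> 'a \<Rightarrow> 'b :: euclidean_space"
  assumes I: "finite I" "indep_vars (\<lambda>_. borel) V I"
    and V2: "\<And>i. i \<in> I \<Longrightarrow> integrable M (\<lambda>\<omega>. (norm (V i \<omega>))\<^sup>2)"
  shows "integrable M (\<lambda>\<omega>. (norm ((\<Sum>i\<in>I. V i \<omega>) + c))\<^sup>2)"
    and "expectation (\<lambda>\<omega>. (norm ((\<Sum>i\<in>I. V i \<omega>) + c))\<^sup>2)
      \<le> (\<Sum>i\<in>I. expectation (\<lambda>\<omega>. (norm (V i \<omega>))\<^sup>2)) + (norm ((\<Sum>i\<in>I. expectation (V i)) + c))\<^sup>2"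
proof -
  have rv: "V i \<in> borel_measurable M" if "i \<in> I" for i
    using I(2) that by (auto simp: indep_vars_def)
  have int: "integrable M (V j)" if "j \<in> I" for j
    using square_integrable_imp_integrable[of "\<lambda>\<omega>. norm (V j \<omega>)"] V2[OF that] rv[OF that]
    by (simp add: integrable_norm_iff)
  have V2b: "integrable M (\<lambda>\<omega>. (V i \<omega> \<bullet> b)\<^sup>2)" if "i \<in> I" "b \<in> Basis" for i b
  proof (rule Bochner_Integration.integrable_bound[OF V2[OF that(1)]])
    show "(\<lambda>\<omega>. (V i \<omega> \<bullet> b)\<^sup>2) \<in> borel_measurable M" using rv[OF that(1)] by simp
    show "AE \<omega> in M. norm ((V i \<omega> \<bullet> b)\<^sup>2) \<le> norm ((norm (V i \<omega>))\<^sup>2)"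
      using Basis_le_norm[OF that(2)] by (auto intro!: power2_le_iff_abs_le[THEN iffD2])
  qed
  have indb: "indep_vars (\<lambda>_. borel) (\<lambda>i \<omega>. V i \<omega> \<bullet> b) I" for b
    by (rule indep_vars_compose2[OF I(2)]) simp
  have eq: "(norm ((\<Sum>i\<in>I. V i \<omega>) + c))\<^sup>2 = (\<Sum>b\<in>Basis. ((\<Sum>i\<in>I. V i \<omega> \<bullet> b) + c \<bullet> b)\<^sup>2)" for \<omega>
    by (simp add: norm_square_eq_sum_Basis inner_sum_left inner_add_left)
  note B = indep_vars_affine_square_le[OF I(1) indb V2b]
  show "integrable M (\<lambda>\<omega>. (norm ((\<Sum>i\<in>I. V i \<omega>) + c))\<^sup>2)"
    unfolding eq by (intro Bochner_Integration.integrable_sum B) auto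
  have "expectation (\<lambda>\<omega>. (norm ((\<Sum>i\<in>I. V i \<omega>) + c))\<^sup>2) =
      (\<Sum>b\<in>Basis. expectation (\<lambda>\<omega>. ((\<Sum>i\<in>I. V i \<omega> \<bullet> b) + c \<bullet> b)\<^sup>2))"
    unfolding eq by (intro Bochner_Integration.integral_sum B) auto
  also have "\<dots> \<le> (\<Sum>b\<in>Basis. (\<Sum>i\<in>I. expectation (\<lambda>\<omega>. (V i \<omega> \<bullet> b)\<^sup>2)) +
      ((\<Sum>i\<in>I. expectation (\<lambda>\<omega>. V i \<omega> \<bullet> b)) + c \<bullet> b)\<^sup>2)"
    by (intro sum_mono B) auto
  also have "\<dots> = (\<Sum>i\<in>I. \<Sum>b\<in>Basis. expectation (\<lambda>\<omega>. (V i \<omega> \<bullet> b)\<^sup>2)) +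
      (\<Sum>b\<in>Basis. (((\<Sum>i\<in>I. expectation (V i)) + c) \<bullet> b)\<^sup>2)"
    using int by (subst sum.swap) (simp add: sum.distrib inner_sum_left inner_add_left)
  also have "(\<Sum>i\<in>I. \<Sum>b\<in>Basis. expectation (\<lambda>\<omega>. (V i \<omega> \<bullet> b)\<^sup>2)) =
      (\<Sum>i\<in>I. expectation (\<lambda>\<omega>. (norm (V i \<omega>))\<^sup>2))"
    unfolding norm_square_eq_sum_Basis using V2b by (intro sum.cong refl) (simp add: Bochner_Integration.integral_sum)
  finally show "expectation (\<lambda>\<omega>. (norm ((\<Sum>i\<in>I. V i \<omega>) + c))\<^sup>2)
      \<le> (\<Sum>i\<in>I. expectation (\<lambda>\<omega>. (norm (V i \<omega>))\<^sup>2)) + (norm ((\<Sum>i\<in>I. expectation (V i)) + c))\<^sup>2"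
    unfolding norm_square_eq_sum_Basis[symmetric] .
qed

text \<open>Nonnegativity of the variance of \<open>norm (f x)\<close> takes the place of Jensen's
  inequality.\<close>

lemma norm_expectation_square_le:
  fixes f :: "'a \<Rightarrow> 'b :: {banach, second_countable_topology}"
  assumes [measurable]: "f \<in> borel_measurable M" and f2: "integrable M (\<lambda>x. (norm (f x))\<^sup>2)"
  shows "(norm (expectation f))\<^sup>2 \<le> expectation (\<lambda>x. (norm (f x))\<^sup>2)"
proof -
  have int: "integrable M (\<lambda>x. norm (f x))"
    by (rule square_integrable_imp_integrable) (use f2 in auto)
  have "(norm (expectation f))\<^sup>2 \<le> (expectation (\<lambda>x. norm (f x)))\<^sup>2"
    by (intro power_mono) auto
  also have "\<dots> \<le> expectation (\<lambda>x. (norm (f x))\<^sup>2)"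
    using variance_positive[of "\<lambda>x. norm (f x)"] variance_eq[OF int f2] by simp
  finally show ?thesis .
qed

end

section \<open>Splitting and reindexing infinite product measures\<close>

text \<open>Inserting a coordinate carries the pair measure to the product over
  \<open>insert j I\<close>, and the splitting map is a left inverse of that insertion.\<close>

lemma distr_PiM_insert_split:
  assumes M: "\<And>i. i \<in> insert j I \<Longrightarrow> prob_space (M i)" and j: "j \<notin> I"
  shows "distr (PiM (insert j I) M) (M j \<Otimes>\<^sub>M PiM I M) (\<lambda>w. (w j, restrict w I)) = M j \<Otimes>\<^sub>M PiM I M"
proof -
  have "distr (PiM (insert j I) M) (M j \<Otimes>\<^sub>M PiM I M) (\<lambda>w. (w j, restrict w I)) =
    distr (distr (M j \<Otimes>\<^sub>M PiM I M) (PiM (insert j I) M) (\<lambda>(x, w). w(j := x)))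
      (M j \<Otimes>\<^sub>M PiM I M) (\<lambda>w. (w j, restrict w I))"
    by (subst distr_pair_PiM_eq_PiM) (use M in auto)
  also have "\<dots> = distr (M j \<Otimes>\<^sub>M PiM I M) (M j \<Otimes>\<^sub>M PiM I M) (\<lambda>x. x)"
  proof (subst distr_distr)
    show "(\<lambda>w. (w j, restrict w I)) \<in> PiM (insert j I) M \<rightarrow>\<^sub>M M j \<Otimes>\<^sub>M PiM I M"
      by (intro measurable_Pair measurable_component_singleton measurable_restrict_subset) auto
    show "distr (M j \<Otimes>\<^sub>M PiM I M) (M j \<Otimes>\<^sub>M PiM I M) ((\<lambda>w. (w j, restrict w I)) \<circ> (\<lambda>(x, w). w(j := x)))
      = distr (M j \<Otimes>\<^sub>M PiM I M) (M j \<Otimes>\<^sub>M PiM I M) (\<lambda>x. x)"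
      using j by (intro distr_cong refl)
        (auto simp: space_pair_measure space_PiM PiE_def extensional_def fun_eq_iff)
  qed simp
  finally show ?thesis by (simp add: distr_id2)
qed

text \<open>The joint law of the coordinates is the law of the identity, hence the product of the
  marginals.\<close>

lemma indep_vars_PiM_components:
  assumes "I \<noteq> {}" and M: "\<And>i. i \<in> I \<Longrightarrow> prob_space (M i)"
  shows "prob_space.indep_vars (PiM I M) M (\<lambda>i w. w i) I"
proof -
  interpret P: prob_space "PiM I M" by (rule prob_space_PiM) (use M in auto)
  have "distr (PiM I M) (PiM I M) (\<lambda>w. \<lambda>i\<in>I. w i) = distr (PiM I M) (PiM I M) (\<lambda>w. w)"
    by (intro distr_cong refl) (auto simp: space_PiM PiE_def extensional_def fun_eq_iff)
  also have "\<dots> = PiM I M" by (simp add: distr_id2)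
  also have "\<dots> = PiM I (\<lambda>i. distr (PiM I M) (M i) (\<lambda>w. w i))"
    by (intro PiM_cong refl distr_PiM_component[symmetric] M) auto
  finally show ?thesis
    by (subst P.indep_vars_iff_distr_eq_PiM') (use assms in auto)
qed

section \<open>Multilevel Picard approximations on the product space\<close>

text \<open>The descendants of \<open>p\<close>, relabelled by their suffixes, so that a recursive
  call again receives a family indexed by \<open>Theta\<close>. The suffix \<open>[]\<close> lies
  outside \<open>Theta\<close>, so \<open>p\<close> itself is left out; this is what makes
  \<open>w p\<close> independent of \<open>subfamily p w\<close>.\<close>

definition subfamily :: "int list \<Rightarrow> (int list \<Rightarrow> 'a) \<Rightarrow> int list \<Rightarrow> 'a" where
  "subfamily p w = (\<lambda>\<eta>\<in>Theta. w (p @ \<eta>))"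

lemma measurable_subfamily:
  assumes "\<And>\<eta>. \<eta> \<noteq> [] \<Longrightarrow> p @ \<eta> \<in> J"
  shows "subfamily p \<in> PiM J (\<lambda>_. Q) \<rightarrow>\<^sub>M PiM Theta (\<lambda>_. Q)"
  unfolding subfamily_def
  by (intro measurable_restrict measurable_component_singleton) (use assms in \<open>auto simp: Theta_def\<close>)

lemma distr_subfamily:
  assumes "prob_space Q"
  shows "distr (PiM Theta (\<lambda>_. Q)) (PiM Theta (\<lambda>_. Q)) (subfamily p) = PiM Theta (\<lambda>_. Q)"
  unfolding subfamily_def
  by (rule distr_PiM_reindex) (use assms in \<open>auto simp: Theta_def inj_on_def\<close>)

text \<open>The free index \<open>[]\<close> is made to stand for \<open>p\<close>: the map sending
  \<open>[]\<close> to \<open>p\<close> and every other list to \<open>p' @ \<eta>\<close> is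
  injective, so reindexing followed by splitting off \<open>[]\<close> yields the product law. It is
  applied with \<open>p' = p\<close> and with \<open>p'\<close> obtained from \<open>p\<close> by
  flipping the sign of the last entry.\<close>

lemma distr_component_subfamily:
  assumes Q: "prob_space Q" and p: "p \<noteq> []" and p': "\<And>\<eta>. \<eta> \<noteq> [] \<Longrightarrow> p \<noteq> p' @ \<eta>"
  shows "distr (PiM Theta (\<lambda>_. Q)) (Q \<Otimes>\<^sub>M PiM Theta (\<lambda>_. Q)) (\<lambda>w. (w p, subfamily p' w))
    = Q \<Otimes>\<^sub>M PiM Theta (\<lambda>_. Q)"
proof -
  define f where "f \<eta> = (if \<eta> = [] then p else p' @ \<eta>)" for \<eta>
  let ?R = "\<lambda>w :: int list \<Rightarrow> 'a. (w [], restrict w Theta)"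
  let ?U = "insert [] Theta"
  have UN: "?U = UNIV" by (auto simp: Theta_def)
  have re: "distr (PiM Theta (\<lambda>_. Q)) (PiM ?U (\<lambda>_. Q)) (\<lambda>w. \<lambda>\<eta>\<in>?U. w (f \<eta>)) = PiM ?U (\<lambda>_. Q)"
    by (rule distr_PiM_reindex)
      (use Q p p' in \<open>auto simp: f_def inj_on_def Theta_def split: if_splits dest!: p'[THEN not_sym]\<close>)
  have m1: "(\<lambda>w. \<lambda>\<eta>\<in>?U. w (f \<eta>)) \<in> PiM Theta (\<lambda>_. Q) \<rightarrow>\<^sub>M PiM ?U (\<lambda>_. Q)"
    by (intro measurable_restrict measurable_component_singleton) (auto simp: f_def p Theta_def)
  have m2: "?R \<in> PiM ?U (\<lambda>_. Q) \<rightarrow>\<^sub>M Q \<Otimes>\<^sub>M PiM Theta (\<lambda>_. Q)"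
    by (intro measurable_Pair measurable_component_singleton measurable_restrict_subset) auto
  have "Q \<Otimes>\<^sub>M PiM Theta (\<lambda>_. Q) = distr (PiM ?U (\<lambda>_. Q)) (Q \<Otimes>\<^sub>M PiM Theta (\<lambda>_. Q)) ?R"
    by (rule distr_PiM_insert_split[symmetric]) (auto simp: Q Theta_def)
  also have "\<dots> = distr (PiM Theta (\<lambda>_. Q)) (Q \<Otimes>\<^sub>M PiM Theta (\<lambda>_. Q)) (?R \<circ> (\<lambda>w. \<lambda>\<eta>\<in>?U. w (f \<eta>)))"
    by (subst re[symmetric]) (rule distr_distr[OF m2 m1])
  also have "?R \<circ> (\<lambda>w. \<lambda>\<eta>\<in>?U. w (f \<eta>)) = (\<lambda>w. (w p, subfamily p' w))"
    by (auto simp: f_def subfamily_def Theta_def fun_eq_iff)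
  finally show ?thesis by simp
qed

text \<open>
  The component \<open>w \<theta>\<close> of a sample point holds the realization of \<open>(Z\<^sup>\<theta>, r\<^sup>\<theta>)\<close>.  The term
  with \<open>F (\<xi>, Z)\<close> of the recursion is the summand \<open>l = 0\<close>, since \<open>mlp F \<xi> m 0\<close> is constantly \<open>\<xi>\<close>.
\<close>
function mlp :: "('a::real_vector \<Rightarrow> 's \<Rightarrow> 'a) \<Rightarrow> 'a \<Rightarrow> nat \<Rightarrow> nat \<Rightarrow> real \<Rightarrow> (int list \<Rightarrow> 's \<times> real) \<Rightarrow> 'a"
  where
  "mlp F \<xi> m n t w = (\<Sum>l<n. \<Sum>k\<in>{1..m ^ (n - l)}. (t / real m ^ (n - l)) *\<^sub>R
     (F (mlp F \<xi> m l (snd (w [int l, int k]) * t) (subfamily [int l, int k] w)) (fst (w [int l, int k])) -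
      (if l = 0 then 0 else
        F (mlp F \<xi> m (l - 1) (snd (w [int l, int k]) * t) (subfamily [int l, - int k] w)) (fst (w [int l, int k]))))) + \<xi>"
  by pat_completeness auto
termination by (relation "Wellfounded.measure (\<lambda>(F, \<xi>, m, n, t, w). n)") auto

declare mlp.simps [simp del]

text \<open>Both terms share the random time and the sample at \<open>[l, k]\<close>; only the
  families fed to the two approximations differ. This coupling makes the difference small as soon as
  both approximations are close to the exact solution.\<close>

definition mlp_diff where
  "mlp_diff F \<xi> m l k t w =
     F (mlp F \<xi> m l (snd (w [int l, int k]) * t) (subfamily [int l, int k] w)) (fst (w [int l, int k])) -
      (if l = 0 then 0 else
        F (mlp F \<xi> m (l - 1) (snd (w [int l, int k]) * t) (subfamily [int l, - int k] w)) (fst (w [int l, int k])))"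

lemma mlp_0: "mlp F \<xi> m 0 t w = \<xi>"
  by (subst mlp.simps) simp

lemma mlp_eq:
  "mlp F \<xi> m n t w = (\<Sum>(l, k)\<in>(SIGMA l:{..<n}. {1..m ^ (n - l)}). (t / real m ^ (n - l)) *\<^sub>R mlp_diff F \<xi> m l k t w) + \<xi>"
  by (subst mlp.simps, subst sum.Sigma[symmetric]) (simp_all add: mlp_diff_def)

text \<open>The coordinates that \<open>mlp_diff\<close> at \<open>(l, k)\<close> reads. Both signs
  belong to one block because the two terms share a sample and are therefore not independent of each
  other.\<close>

definition branch :: "nat \<times> nat \<Rightarrow> int list set" where
  "branch = (\<lambda>(l, k). {\<eta>. take 2 \<eta> = [int l, int k] \<or> take 2 \<eta> = [int l, - int k]})"

lemma branch_subset: "branch j \<subseteq> Theta"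
  by (auto simp: branch_def Theta_def)

lemma disjoint_branch: "disjoint_family_on branch (UNIV \<times> {1..})"
  by (auto simp: disjoint_family_on_def branch_def)

lemma mlp_diff_restrict: "mlp_diff F \<xi> m l k t (restrict w (branch (l, k))) = mlp_diff F \<xi> m l k t w"
proof -
  have "subfamily p (restrict w (branch (l, k))) = subfamily p w" if "p = [int l, int k] \<or> p = [int l, - int k]" for p
    using that by (auto simp: subfamily_def branch_def fun_eq_iff)
  moreover have "[int l, int k] \<in> branch (l, k)" by (simp add: branch_def)
  ultimately show ?thesis unfolding mlp_diff_def by simp
qed

text \<open>Joint measurability in time and family is required because the recursion evaluates
  approximations at random times. The hypothesis on the levels up to \<open>l\<close> lets the
  induction for \<open>mlp\<close> pass through \<open>mlp_diff\<close>; the index set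
  \<open>J\<close> is kept general to cover both all of \<open>Theta\<close> and a single
  \<open>branch\<close>.\<close>

lemma measurable_mlp_diff_aux:
  assumes F: "case_prod F \<in> borel \<Otimes>\<^sub>M S \<rightarrow>\<^sub>M borel" and Q: "sets Q = sets (S \<Otimes>\<^sub>M borel)"
    and mlp: "\<And>l'. l' \<le> l \<Longrightarrow> (\<lambda>(t, w). mlp F \<xi> m l' t w) \<in> borel \<Otimes>\<^sub>M PiM Theta (\<lambda>_. Q) \<rightarrow>\<^sub>M borel"
    and J: "branch (l, k) \<subseteq> J"
  shows "(\<lambda>(t, w). mlp_diff F \<xi> m l k t w :: 'a :: euclidean_space) \<in> borel \<Otimes>\<^sub>M PiM J (\<lambda>_. Q) \<rightarrow>\<^sub>M borel"
proof -
  let ?N = "borel \<Otimes>\<^sub>M PiM J (\<lambda>_. Q) :: (real \<times> _) measure"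
  have sh [measurable]: "subfamily [int l, int k] \<in> PiM J (\<lambda>_. Q) \<rightarrow>\<^sub>M PiM Theta (\<lambda>_. Q)"
    "subfamily [int l, - int k] \<in> PiM J (\<lambda>_. Q) \<rightarrow>\<^sub>M PiM Theta (\<lambda>_. Q)"
    using J by (auto intro!: measurable_subfamily simp: branch_def)
  have [measurable_cong]: "sets Q = sets (S \<Otimes>\<^sub>M borel)" by (rule Q)
  have [measurable]: "(\<lambda>x. snd x [int l, int k]) \<in> ?N \<rightarrow>\<^sub>M S \<Otimes>\<^sub>M borel"
  proof -
    have "(\<lambda>w. w [int l, int k]) \<in> PiM J (\<lambda>_. Q) \<rightarrow>\<^sub>M Q"
      by (rule measurable_component_singleton) (use J in \<open>auto simp: branch_def\<close>)
    then have "(\<lambda>w. w [int l, int k]) \<in> PiM J (\<lambda>_. Q) \<rightarrow>\<^sub>M S \<Otimes>\<^sub>M borel"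
      by (simp add: measurable_cong_sets[OF refl Q])
    then show ?thesis by simp
  qed
  note [measurable] = F
  have *: "(\<lambda>x. F (mlp F \<xi> m l' (snd (snd x [int l, int k]) * fst x) (subfamily p (snd x))) (fst (snd x [int l, int k]))) \<in> ?N \<rightarrow>\<^sub>M borel"
    if l': "l' \<le> l" and [measurable]: "subfamily p \<in> PiM J (\<lambda>_. Q) \<rightarrow>\<^sub>M PiM Theta (\<lambda>_. Q)" for l' p
  proof -
    note [measurable] = mlp[OF l']
    have "(\<lambda>x. (\<lambda>(t, w). mlp F \<xi> m l' t w) (snd (snd x [int l, int k]) * fst x, subfamily p (snd x))) \<in> ?N \<rightarrow>\<^sub>M borel"
      by measurable
    then have [measurable]: "(\<lambda>x. mlp F \<xi> m l' (snd (snd x [int l, int k]) * fst x) (subfamily p (snd x))) \<in> ?N \<rightarrow>\<^sub>M borel"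
      by simp
    have "(\<lambda>x. case_prod F (mlp F \<xi> m l' (snd (snd x [int l, int k]) * fst x) (subfamily p (snd x)), fst (snd x [int l, int k]))) \<in> ?N \<rightarrow>\<^sub>M borel"
      by measurable
    then show ?thesis by simp
  qed
  show ?thesis
    unfolding mlp_diff_def split_beta
    using *[OF _ sh(1), of l] *[OF _ sh(2), of "l - 1"]
    by (cases "l = 0") (simp_all add: borel_measurable_diff)
qed

lemma measurable_mlp:
  assumes F: "case_prod F \<in> borel \<Otimes>\<^sub>M S \<rightarrow>\<^sub>M borel" and Q: "sets Q = sets (S \<Otimes>\<^sub>M borel)"
  shows "(\<lambda>(t, w). mlp F \<xi> m n t w :: 'a :: euclidean_space) \<in> borel \<Otimes>\<^sub>M PiM Theta (\<lambda>_. Q) \<rightarrow>\<^sub>M borel"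
proof (induction n rule: less_induct)
  case (less n)
  have [measurable]: "(\<lambda>(t, w). mlp_diff F \<xi> m l k t w) \<in> borel \<Otimes>\<^sub>M PiM Theta (\<lambda>_. Q) \<rightarrow>\<^sub>M borel" if "l < n" for l k
    by (rule measurable_mlp_diff_aux[OF F Q]) (use that less.IH branch_subset in auto)
  show ?case
    unfolding mlp_eq[where n = n] split_beta
    by (intro borel_measurable_add borel_measurable_sum borel_measurable_scaleR)
      (auto simp: split_beta[symmetric] intro!: borel_measurable_divide)
qed

lemma measurable_mlp_diff:
  assumes F: "case_prod F \<in> borel \<Otimes>\<^sub>M S \<rightarrow>\<^sub>M borel" and Q: "sets Q = sets (S \<Otimes>\<^sub>M borel)"
    and J: "branch (l, k) \<subseteq> J"
  shows "(\<lambda>w. mlp_diff F \<xi> m l k t w :: 'a :: euclidean_space) \<in> PiM J (\<lambda>_. Q) \<rightarrow>\<^sub>M borel"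
  using measurable_compose[OF measurable_Pair1' measurable_mlp_diff_aux[OF F Q measurable_mlp[OF F Q] J]]
  by simp

text \<open>Coordinates grouped into disjoint blocks stay independent, and each difference factors
  through the restriction to its own \<open>branch\<close>.\<close>

lemma indep_vars_mlp_diff:
  assumes F: "case_prod F \<in> borel \<Otimes>\<^sub>M S \<rightarrow>\<^sub>M borel" and Q: "sets Q = sets (S \<Otimes>\<^sub>M borel)" "prob_space Q"
    and I: "I \<subseteq> UNIV \<times> {1..}"
  shows "prob_space.indep_vars (PiM Theta (\<lambda>_. Q)) (\<lambda>_. borel)
    (\<lambda>(l, k) w. mlp_diff F \<xi> m l k t w :: 'a :: euclidean_space) I"
proof -
  interpret P: prob_space "PiM Theta (\<lambda>_. Q)" by (rule prob_space_PiM) (rule Q)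
  have "P.indep_vars (\<lambda>j. PiM (branch j) (\<lambda>_. Q)) (\<lambda>j w. restrict (\<lambda>i. w i) (branch j)) I"
    by (rule P.indep_vars_restrict[OF indep_vars_PiM_components])
      (use I branch_subset Q disjoint_family_on_mono[OF I disjoint_branch] in \<open>auto simp: Theta_def\<close>)
  then have "P.indep_vars (\<lambda>_. borel)
    (\<lambda>j w. (case j of (l, k) \<Rightarrow> mlp_diff F \<xi> m l k t) (restrict (\<lambda>i. w i) (branch j))) I"
    by (rule P.indep_vars_compose2) (auto intro!: measurable_mlp_diff[OF F Q(1)])
  then show ?thesis
    using mlp_diff_restrict[of F \<xi> m "fst j" "snd j" t for j]
    by (simp add: split_beta')
qed

section \<open>The error bound\<close>

abbreviation (input) unif :: "real measure" where
  "unif \<equiv> uniform_measure lborel {0..1}"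

lemma prob_space_unif: "prob_space unif"
  by (rule prob_space_uniform_measure) auto

lemma AE_unif: "AE r in unif. 0 \<le> r \<and> r \<le> 1"
  by (subst AE_uniform_measure) auto

text \<open>Closed form of the mean of \<open>exp (c * (r * t))\<close> over \<open>r\<close>
  uniform on the unit interval. The quotient would be 0 at \<open>t = 0\<close>, hence the separate
  value there.\<close>

definition exp_mean :: "real \<Rightarrow> real \<Rightarrow> real" where
  "exp_mean c t = (if t = 0 then 1 else (exp (c * t) - 1) / (c * t))"

lemma exp_mean_nonneg: "c > 0 \<Longrightarrow> t \<ge> 0 \<Longrightarrow> exp_mean c t \<ge> 0"
  by (simp add: exp_mean_def)

lemma mult_exp_mean: "c > 0 \<Longrightarrow> t * exp_mean c t = (exp (c * t) - 1) / c"
  by (simp add: exp_mean_def)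

lemma nn_integral_unif_exp:
  assumes "c > 0" "t \<ge> 0"
  shows "(\<integral>\<^sup>+r. ennreal (exp (c * (r * t))) \<partial>unif) = ennreal (exp_mean c t)"
proof (cases "t = 0")
  case True
  interpret prob_space unif by (rule prob_space_unif)
  show ?thesis using True emeasure_space_1 by (simp add: exp_mean_def)
next
  case False
  have "(\<integral>\<^sup>+r. ennreal (exp (c * (r * t))) \<partial>unif) = (\<integral>\<^sup>+r\<in>{0..1}. ennreal (exp (c * (r * t))) \<partial>lborel)"
    by (subst nn_integral_uniform_measure) (auto simp: divide_ennreal_def)
  also have "\<dots> = ennreal (exp (c * (1 * t)) / (c * t) - exp (c * (0 * t)) / (c * t))"
    by (rule nn_integral_FTC_Icc)
      (use assms False in \<open>auto intro!: derivative_eq_intros simp: field_simps\<close>)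
  finally show ?thesis using False by (simp add: exp_mean_def diff_divide_distrib)
qed

lemma integral_le_ennreal:
  fixes f :: "'a \<Rightarrow> real"
  assumes "f \<in> borel_measurable M" "\<And>x. 0 \<le> f x" "0 \<le> B" "(\<integral>\<^sup>+x. ennreal (f x) \<partial>M) \<le> ennreal B"
  shows "integrable M f" "(\<integral>x. f x \<partial>M) \<le> B"
proof -
  show "integrable M f"
    using assms by (intro integrableI_nonneg) (auto intro: le_less_trans)
  show "(\<integral>x. f x \<partial>M) \<le> B"
    using assms by (subst integral_eq_nn_integral) (auto intro!: enn2real_leI)
qed

lemma (in finite_measure) integrable_norm_square_imp_integrable:
  fixes f :: "'a \<Rightarrow> 'b :: euclidean_space"
  assumes "f \<in> borel_measurable M" "integrable M (\<lambda>x. (norm (f x))\<^sup>2)"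
  shows "integrable M f"
  using square_integrable_imp_integrable[of "\<lambda>x. norm (f x)"] assms by (simp add: integrable_norm_iff)

lemma norm_diff_square_le: "(norm (a - b))\<^sup>2 \<le> 2 * ((norm (a - x))\<^sup>2 + (norm (b - x))\<^sup>2)"
  for a b x :: "'a :: real_normed_vector"
proof -
  have "norm (a - b) \<le> norm (a - x) + norm (b - x)"
    using norm_triangle_ineq4[of "a - x" "b - x"] by simp
  then have "(norm (a - b))\<^sup>2 \<le> (norm (a - x) + norm (b - x))\<^sup>2"
    by (intro power_mono) auto
  also have "\<dots> \<le> 2 * ((norm (a - x))\<^sup>2 + (norm (b - x))\<^sup>2)"
    using sum_squares_bound[of "norm (a - x)" "norm (b - x)"] by (simp add: power2_sum)
  finally show ?thesis .
qed

text \<open>In \<open>X_eq\<close> the time integral is already rewritten as \<open>t\<close> times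
  a mean over a uniform \<open>r\<close>, jointly with the law of \<open>Z\<close>. The exact
  solution then solves an equation whose Monte Carlo version is one level of the recursion.
  Everything is measured in the Euclidean norm, and \<open>X\<close> is a continuous extension to
  all real times, while the equation is asked only on \<open>{0..T}\<close>.\<close>

locale mlp_setting =
  fixes \<mu> :: "'s measure" and F :: "'a :: euclidean_space \<Rightarrow> 's \<Rightarrow> 'a" and \<xi> :: 'a
    and X :: "real \<Rightarrow> 'a" and T L :: real and m :: nat
  assumes prob_space_\<mu>: "prob_space \<mu>"
    and measurable_F: "case_prod F \<in> borel \<Otimes>\<^sub>M \<mu> \<rightarrow>\<^sub>M borel"
    and lipschitz: "\<And>x y s. s \<in> space \<mu> \<Longrightarrow> norm (F x s - F y s) \<le> L * norm (x - y)"
    and integrable_F: "integrable \<mu> (\<lambda>s. (norm (F \<xi> s))\<^sup>2)"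
    and L_nonneg: "0 \<le> L" and T_nonneg: "0 \<le> T" and m_pos: "m \<ge> 1"
    and continuous_X: "continuous_on UNIV X"
    and X_eq: "\<And>t. t \<in> {0..T} \<Longrightarrow>
      X t = \<xi> + t *\<^sub>R (\<integral>q. F (X (snd q * t)) (fst q) \<partial>(\<mu> \<Otimes>\<^sub>M unif))"
begin

definition "Q = \<mu> \<Otimes>\<^sub>M unif"
definition "P = PiM Theta (\<lambda>_. Q)"
text \<open>The law of one sample together with an independent family: all that a single evaluation
  of \<open>F\<close> at a randomly timed approximation depends on.\<close>

definition "R = Q \<Otimes>\<^sub>M P"

abbreviation "\<Phi> \<equiv> mlp F \<xi> m"

sublocale \<mu>: prob_space \<mu> by (rule prob_space_\<mu>)
sublocale unif: prob_space unif by (rule prob_space_unif)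
sublocale \<mu>U: pair_prob_space \<mu> unif ..
sublocale Q: prob_space Q unfolding Q_def by (rule \<mu>U.P.prob_space_axioms)
sublocale P: prob_space P unfolding P_def by (rule prob_space_PiM) (rule Q.prob_space_axioms)
sublocale QP: pair_prob_space Q P ..
sublocale R: prob_space R unfolding R_def by (rule QP.P.prob_space_axioms)

lemma sets_Q: "sets Q = sets (\<mu> \<Otimes>\<^sub>M borel)"
  unfolding Q_def by (rule sets_pair_measure_cong) simp_all

lemma sets_R [measurable_cong]: "sets R = sets ((\<mu> \<Otimes>\<^sub>M borel) \<Otimes>\<^sub>M P)"
  unfolding R_def by (rule sets_pair_measure_cong) (simp_all add: sets_Q)

lemma space_Q: "space Q = space \<mu> \<times> UNIV"
  by (simp add: Q_def space_pair_measure)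

lemma space_R: "space R = (space \<mu> \<times> UNIV) \<times> space P"
  by (simp add: R_def space_pair_measure space_Q)

declare measurable_F [measurable]

lemma measurable_X [measurable]: "X \<in> borel_measurable borel"
  using continuous_X by (rule borel_measurable_continuous_onI)

lemma measurable_\<Phi> [measurable]: "(\<lambda>(t, w). \<Phi> n t w) \<in> borel \<Otimes>\<^sub>M P \<rightarrow>\<^sub>M borel"
  unfolding P_def by (rule measurable_mlp[OF measurable_F sets_Q])

lemma measurable_\<Phi>_R [measurable]: "(\<lambda>x. \<Phi> n (snd (fst x) * t) (snd x)) \<in> borel_measurable R"
proof -
  have "(\<lambda>x. case_prod (\<Phi> n) (snd (fst x) * t, snd x)) \<in> borel_measurable R" by measurable
  then show ?thesis by simp
qed

lemma measurable_F_R: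
  assumes [measurable]: "f \<in> borel_measurable R"
  shows "(\<lambda>x. F (f x) (fst (fst x))) \<in> borel_measurable R"
proof -
  have "(\<lambda>x. case_prod F (f x, fst (fst x))) \<in> borel_measurable R" by measurable
  then show ?thesis by simp
qed

lemma measurable_\<Phi>_P [measurable]: "\<Phi> n t \<in> borel_measurable P"
  using measurable_compose[OF measurable_Pair1' measurable_\<Phi>] by simp

lemma distr_R:
  assumes "p \<noteq> []" "\<And>\<eta>. \<eta> \<noteq> [] \<Longrightarrow> p \<noteq> p' @ \<eta>"
  shows "distr P R (\<lambda>w. (w p, subfamily p' w)) = R"
  unfolding R_def P_def by (rule distr_component_subfamily) (use assms Q.prob_space_axioms in auto)

lemma measurable_component_subfamily [measurable]:
  assumes "p \<noteq> []"
  shows "(\<lambda>w. (w p, subfamily p' w)) \<in> P \<rightarrow>\<^sub>M R"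
  unfolding R_def P_def
  by (intro measurable_Pair measurable_component_singleton measurable_subfamily)
    (use assms in \<open>auto simp: Theta_def\<close>)

lemma integrable_R_iff:
  fixes h :: "_ \<Rightarrow> 'b :: {banach, second_countable_topology}"
  assumes "p \<noteq> []" "\<And>\<eta>. \<eta> \<noteq> [] \<Longrightarrow> p \<noteq> p' @ \<eta>" and h: "h \<in> borel_measurable R"
  shows "integrable P (\<lambda>w. h (w p, subfamily p' w)) \<longleftrightarrow> integrable R h"
  using integrable_distr_eq[OF measurable_component_subfamily[OF assms(1), where p' = p'] h] distr_R[OF assms(1,2)] by simp

lemma integral_R_eq:
  fixes h :: "_ \<Rightarrow> 'b :: {banach, second_countable_topology}"
  assumes "p \<noteq> []" "\<And>\<eta>. \<eta> \<noteq> [] \<Longrightarrow> p \<noteq> p' @ \<eta>" and h: "h \<in> borel_measurable R"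
  shows "(\<integral>w. h (w p, subfamily p' w) \<partial>P) = (\<integral>x. h x \<partial>R)"
  using integral_distr[OF measurable_component_subfamily[OF assms(1), where p' = p'] h] distr_R[OF assms(1,2)] by simp

lemma integral_R_fst:
  fixes h :: "_ \<Rightarrow> 'b :: {banach, second_countable_topology}"
  assumes h: "h \<in> borel_measurable Q"
  shows "(\<integral>x. h (fst x) \<partial>R) = (\<integral>q. h q \<partial>Q)"
proof -
  have "distr R Q fst = Q" unfolding R_def by (rule P.distr_pair_fst)
  then show ?thesis using integral_distr[of fst R Q h] h by (simp add: R_def)
qed

lemma integrable_R_fst_fst:
  fixes h :: "_ \<Rightarrow> 'b :: {banach, second_countable_topology}"
  assumes h: "h \<in> borel_measurable \<mu>"
  shows "integrable R (\<lambda>x. h (fst (fst x))) \<longleftrightarrow> integrable \<mu> h"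
    and "(\<integral>x. h (fst (fst x)) \<partial>R) = (\<integral>s. h s \<partial>\<mu>)"
proof -
  have "distr R \<mu> (\<lambda>x. fst (fst x)) = distr (distr R Q fst) \<mu> fst"
    unfolding R_def Q_def by (subst distr_distr) (simp_all add: comp_def)
  also have "distr R Q fst = Q" unfolding R_def by (rule P.distr_pair_fst)
  also have "distr Q \<mu> fst = \<mu>" unfolding Q_def by (rule unif.distr_pair_fst)
  finally have d: "distr R \<mu> (\<lambda>x. fst (fst x)) = \<mu>" .
  have ms: "(\<lambda>x. fst (fst x)) \<in> R \<rightarrow>\<^sub>M \<mu>" by measurable
  show "integrable R (\<lambda>x. h (fst (fst x))) \<longleftrightarrow> integrable \<mu> h"
    using integrable_distr_eq[OF ms h] d by simp
  show "(\<integral>x. h (fst (fst x)) \<partial>R) = (\<integral>s. h s \<partial>\<mu>)"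
    using integral_distr[OF ms h] d by simp
qed

definition err :: "nat \<Rightarrow> real \<Rightarrow> (int list \<Rightarrow> 's \<times> real) \<Rightarrow> real" where
  "err n t w = (norm (\<Phi> n t w - X t))\<^sup>2"

definition err_R :: "nat \<Rightarrow> real \<Rightarrow> ('s \<times> real) \<times> (int list \<Rightarrow> 's \<times> real) \<Rightarrow> real" where
  "err_R n t = (\<lambda>(q, w). err n (snd q * t) w)"

lemma measurable_err_R [measurable]: "err_R n t \<in> borel_measurable R"
  unfolding err_R_def err_def split_beta' by measurable

lemma err_R_nonneg: "0 \<le> err_R n t x"
  by (auto simp: err_R_def err_def split_beta)

text \<open>Integrability is part of the predicate because the Bochner integral of a non-integrable
  function is 0, so the inequality alone would carry no information.\<close>

definition err_le :: "nat \<Rightarrow> real \<Rightarrow> real \<Rightarrow> bool" where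
  "err_le n H c \<longleftrightarrow> (\<forall>t\<in>{0..T}. integrable P (err n t) \<and> (\<integral>w. err n t w \<partial>P) \<le> H * exp (c * t))"

text \<open>Integrability under \<open>R\<close> is not known in advance, so Tonelli is applied to
  nonnegative integrals: first over the family at a fixed time \<open>r * t\<close>, which almost
  surely lies in \<open>{0..T}\<close>, then over \<open>r\<close>, where the exponential weight
  averages to \<open>exp_mean\<close>.\<close>

lemma err_R_le:
  assumes n: "err_le n H c" and "0 \<le> H" "0 < c" and t: "t \<in> {0..T}"
  shows "integrable R (err_R n t)" "(\<integral>x. err_R n t x \<partial>R) \<le> H * exp_mean c t"
proof -
  have inner: "(\<integral>\<^sup>+w. ennreal (err n (r * t) w) \<partial>P) \<le> ennreal (H * exp (c * (r * t)))"
    if "0 \<le> r \<and> r \<le> 1" for r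
  proof -
    have "r * t \<in> {0..T}"
      using that t mult_mono[of r 1 t T] by auto
    then have "integrable P (err n (r * t))" "(\<integral>w. err n (r * t) w \<partial>P) \<le> H * exp (c * (r * t))"
      using n by (auto simp: err_le_def)
    then show ?thesis
      by (subst nn_integral_eq_integral) (auto simp: err_def[abs_def] intro: ennreal_leI)
  qed
  have meas: "(\<lambda>x. ennreal (err_R n t x)) \<in> borel_measurable (Q \<Otimes>\<^sub>M P)"
    using measurable_err_R[of n t] unfolding R_def by measurable
  have "(\<integral>\<^sup>+x. ennreal (err_R n t x) \<partial>R) = (\<integral>\<^sup>+q. \<integral>\<^sup>+w. ennreal (err n (snd q * t) w) \<partial>P \<partial>Q)"
    using P.nn_integral_fst[OF meas] by (simp add: R_def err_R_def)
  also have "\<dots> = (\<integral>\<^sup>+s. \<integral>\<^sup>+r. \<integral>\<^sup>+w. ennreal (err n (r * t) w) \<partial>P \<partial>unif \<partial>\<mu>)"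
  proof -
    have "(\<lambda>q. \<integral>\<^sup>+w. ennreal (err n (snd q * t) w) \<partial>P) \<in> borel_measurable (\<mu> \<Otimes>\<^sub>M unif)"
      using P.borel_measurable_nn_integral_fst[OF meas] by (simp add: err_R_def Q_def)
    from unif.nn_integral_fst[OF this] show ?thesis by (simp add: Q_def)
  qed
  also have "\<dots> \<le> (\<integral>\<^sup>+s. \<integral>\<^sup>+r. ennreal (H * exp (c * (r * t))) \<partial>unif \<partial>\<mu>)"
    using AE_unif inner by (intro nn_integral_mono nn_integral_mono_AE) auto
  also have "\<dots> = (\<integral>\<^sup>+r. ennreal H * ennreal (exp (c * (r * t))) \<partial>unif)"
    using \<open>0 \<le> H\<close> by (simp add: \<mu>.emeasure_space_1 ennreal_mult)
  also have "\<dots> = ennreal H * (\<integral>\<^sup>+r. ennreal (exp (c * (r * t))) \<partial>unif)"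
    by (rule nn_integral_cmult) simp
  also have "\<dots> = ennreal (H * exp_mean c t)"
    using assms by (subst nn_integral_unif_exp) (auto simp: ennreal_mult exp_mean_nonneg)
  finally have *: "(\<integral>\<^sup>+x. ennreal (err_R n t x) \<partial>R) \<le> ennreal (H * exp_mean c t)" .
  show "integrable R (err_R n t)" "(\<integral>x. err_R n t x \<partial>R) \<le> H * exp_mean c t"
    using integral_le_ennreal[OF measurable_err_R err_R_nonneg _ *] assms by (auto simp: exp_mean_nonneg)
qed

definition mean_err :: "nat \<Rightarrow> real \<Rightarrow> real" where
  "mean_err l t = (\<integral>x. err_R l t x \<partial>R)"

definition K :: real where
  "K = (\<integral>s. (norm (F \<xi> s))\<^sup>2 \<partial>\<mu>)"

text \<open>
  The \<open>l\<close>-th summand estimates the variance of level \<open>l\<close>, which uses \<open>m ^ (n - l)\<close> independent samples;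
  the last term estimates the squared bias.
\<close>
lemma mlp_recursion:
  assumes n: "n \<ge> 1" and H: "\<And>l. l < n \<Longrightarrow> 0 \<le> H l" and c: "0 < c"
    and e: "\<And>l. l < n \<Longrightarrow> err_le l (H l) c" and t: "t \<in> {0..T}"
  shows "integrable P (err n t)"
    and "(\<integral>w. err n t w \<partial>P) \<le>
      (\<Sum>l<n. t\<^sup>2 / real m ^ (n - l) * (if l = 0 then K else 2 * L\<^sup>2 * (mean_err l t + mean_err (l - 1) t)))
        + t\<^sup>2 * L\<^sup>2 * mean_err (n - 1) t"
proof -
  \<comment> \<open>Every difference in the recursion becomes a difference of values of
    \<open>h\<close> at one and the same sample. \<open>hX\<close> is its exact counterpart and
    ignores the family component.\<close>
  define h where "h l x = F (\<Phi> l (snd (fst x) * t) (snd x)) (fst (fst x))"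
    for l and x :: "('s \<times> real) \<times> (int list \<Rightarrow> 's \<times> real)"
  define hX where "hX x = F (X (snd (fst x) * t)) (fst (fst x))"
    for x :: "('s \<times> real) \<times> (int list \<Rightarrow> 's \<times> real)"
  define B where "B l = (if l = 0 then K else 2 * L\<^sup>2 * (mean_err l t + mean_err (l - 1) t))" for l
  define I where "I = (SIGMA l:{..<n}. {1..m ^ (n - l)})"
  define V where "V = (\<lambda>(l, k) w. (t / real m ^ (n - l)) *\<^sub>R mlp_diff F \<xi> m l k t w)"
  define A where "A l = (\<integral>x. h l x \<partial>R)" for l
  have I: "finite I" "I \<subseteq> UNIV \<times> {1..}" by (auto simp: I_def)
  have [measurable]: "h l \<in> borel_measurable R" for l
    unfolding h_def by (rule measurable_F_R) measurable
  have [measurable]: "hX \<in> borel_measurable R"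
    unfolding hX_def by (rule measurable_F_R) measurable
  have [measurable]: "F \<xi> \<in> borel_measurable \<mu>"
    using measurable_compose[OF measurable_Pair1' measurable_F] by simp
  have S: "integrable R (err_R l t)" if "l < n" for l
    using err_R_le[OF e[OF that] H[OF that] c t] by simp
  have hhX: "(norm (h l x - hX x))\<^sup>2 \<le> L\<^sup>2 * err_R l t x" if "x \<in> space R" for l x
  proof -
    have "norm (h l x - hX x) \<le> L * norm (\<Phi> l (snd (fst x) * t) (snd x) - X (snd (fst x) * t))"
      unfolding h_def hX_def by (rule lipschitz) (use that in \<open>auto simp: space_R\<close>)
    then have "(norm (h l x - hX x))\<^sup>2 \<le> (L * norm (\<Phi> l (snd (fst x) * t) (snd x) - X (snd (fst x) * t)))\<^sup>2"
      by (intro power_mono) auto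
    then show ?thesis by (simp add: err_R_def err_def split_beta power_mult_distrib)
  qed
  have hhX_sq: "integrable R (\<lambda>x. (norm (h l x - hX x))\<^sup>2)" if "l < n" for l
    using hhX by (intro Bochner_Integration.integrable_bound[OF integrable_mult_right[OF S[OF that], of "L\<^sup>2"]])
      (auto intro!: AE_I2 abs_ge_self[THEN order_trans[rotated]])
  have hhX_int: "integrable R (\<lambda>x. h l x - hX x)" if "l < n" for l
  proof (rule R.integrable_norm_square_imp_integrable)
    show "(\<lambda>x. h l x - hX x) \<in> borel_measurable R" by measurable
    show "integrable R (\<lambda>x. (norm (h l x - hX x))\<^sup>2)" by (rule hhX_sq[OF that])
  qed
  have h0: "h 0 x = F \<xi> (fst (fst x))" for x by (simp add: h_def mlp_0)
  have "integrable \<mu> (F \<xi>)"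
    by (rule \<mu>.integrable_norm_square_imp_integrable) (use integrable_F in auto)
  then have "integrable R (h 0)"
    using integrable_R_fst_fst(1)[of "F \<xi>"] by (simp add: h0[abs_def])
  \<comment> \<open>\<open>h 0\<close> is \<open>F \<xi>\<close> at the sample, hence integrable by
    assumption, and the Lipschitz bound makes \<open>h 0 - hX\<close> integrable; every other
    \<open>h l\<close> is then reached through \<open>hX\<close>.\<close>
  then have hX_int: "integrable R hX"
    using Bochner_Integration.integrable_diff[of R "h 0" "\<lambda>x. h 0 x - hX x"] hhX_int[of 0] n by simp
  have h_int: "integrable R (h l)" if "l < n" for l
    using Bochner_Integration.integrable_add[OF hX_int hhX_int[OF that]] by simp

  have D: "mlp_diff F \<xi> m l k t w = h l (w [int l, int k], subfamily [int l, int k] w) -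
      (if l = 0 then 0 else h (l - 1) (w [int l, int k], subfamily [int l, - int k] w))" for l k w
    by (simp add: mlp_diff_def h_def)
  have D_meas [measurable]: "mlp_diff F \<xi> m l k t \<in> borel_measurable P" for l k
    unfolding P_def using measurable_mlp_diff[OF measurable_F sets_Q branch_subset] by simp
  have pR: "(w [int l, int k], subfamily p w) \<in> space R" if "w \<in> space P" for w l k p
    using measurable_space[OF measurable_component_subfamily that] by simp
  have ED: "(\<integral>w. mlp_diff F \<xi> m l k t w \<partial>P) = A l - (if l = 0 then 0 else A (l - 1))" if "l < n" for l k
  proof -
    let ?p = "[int l, int k]"
    have "integrable P (\<lambda>w. h a (w ?p, subfamily p' w)) \<and> (\<integral>w. h a (w ?p, subfamily p' w) \<partial>P) = A a"
      if "a < n" "length p' = 2" for a p'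
    proof -
      have "?p \<noteq> p' @ \<eta>" if "\<eta> \<noteq> []" for \<eta>
        using \<open>length p' = 2\<close> that by (auto dest!: arg_cong[where f = length])
      then show ?thesis
        using integral_R_eq[of ?p p' "h a"] integrable_R_iff[of ?p p' "h a"] h_int[OF that(1)]
        by (simp add: A_def)
    qed
    from this[of l ?p] this[of "l - 1" "[int l, - int k]"] show ?thesis
      using that by (cases "l = 0") (auto simp: D)
  qed
  have D2: "integrable P (\<lambda>w. (norm (mlp_diff F \<xi> m l k t w))\<^sup>2) \<and>
     (\<integral>w. (norm (mlp_diff F \<xi> m l k t w))\<^sup>2 \<partial>P) \<le> B l" if l: "l < n" for l k
  proof (cases "l = 0")
    case True
    have *: "(\<lambda>x. (norm (F \<xi> (fst (fst x))))\<^sup>2) \<in> borel_measurable R" by measurable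
    show ?thesis
      using integrable_F integrable_R_fst_fst[of "\<lambda>s. (norm (F \<xi> s))\<^sup>2"]
        integral_R_eq[OF _ _ *, of "[0, int k]" "[0, int k]"]
        integrable_R_iff[OF _ _ *, of "[0, int k]" "[0, int k]"]
      by (simp add: True D h0 B_def K_def)
  next
    case False
    let ?p = "[int l, int k]"
    let ?b = "\<lambda>w. 2 * L\<^sup>2 * (err_R l t (w ?p, subfamily ?p w) + err_R (l - 1) t (w ?p, subfamily [int l, - int k] w))"
    have l': "l - 1 < n" using l by simp
    have b: "(norm (mlp_diff F \<xi> m l k t w))\<^sup>2 \<le> ?b w" if "w \<in> space P" for w
    proof -
      \<comment> \<open>Since \<open>hX\<close> sees only the shared sample, it can be subtracted
        from both terms without changing the difference; each remainder is an error of one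
        level.\<close>
      have X': "hX (w ?p, subfamily [int l, - int k] w) = hX (w ?p, subfamily ?p w)" by (simp add: hX_def)
      have "(norm (mlp_diff F \<xi> m l k t w))\<^sup>2 \<le>
         2 * ((norm (h l (w ?p, subfamily ?p w) - hX (w ?p, subfamily ?p w)))\<^sup>2 +
           (norm (h (l - 1) (w ?p, subfamily [int l, - int k] w) - hX (w ?p, subfamily [int l, - int k] w)))\<^sup>2)"
        unfolding D X' using False norm_diff_square_le by simp
      also have "\<dots> \<le> 2 * (L\<^sup>2 * err_R l t (w ?p, subfamily ?p w) + L\<^sup>2 * err_R (l - 1) t (w ?p, subfamily [int l, - int k] w))"
        by (intro mult_left_mono add_mono hhX pR that) simp
      finally show ?thesis by (simp add: algebra_simps)
    qed
    have int: "integrable P (\<lambda>w. err_R l t (w ?p, subfamily ?p w))"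
      "integrable P (\<lambda>w. err_R (l - 1) t (w ?p, subfamily [int l, - int k] w))"
      using S[OF l] S[OF l'] integrable_R_iff[of ?p ?p "err_R l t"]
        integrable_R_iff[of ?p "[int l, - int k]" "err_R (l - 1) t"] by auto
    then have intb: "integrable P ?b" by simp
    have int2: "integrable P (\<lambda>w. (norm (mlp_diff F \<xi> m l k t w))\<^sup>2)"
      using b by (intro Bochner_Integration.integrable_bound[OF intb])
        (auto intro!: AE_I2 abs_ge_self[THEN order_trans[rotated]])
    have "(\<integral>w. (norm (mlp_diff F \<xi> m l k t w))\<^sup>2 \<partial>P) \<le> (\<integral>w. ?b w \<partial>P)"
      by (rule integral_mono[OF int2 intb b])
    also have "\<dots> = B l"
      using int False integral_R_eq[of ?p ?p "err_R l t"]
        integral_R_eq[of ?p "[int l, - int k]" "err_R (l - 1) t"]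
      by (simp add: B_def mean_err_def)
    finally show ?thesis using int2 by simp
  qed
  have V2: "integrable P (\<lambda>w. (norm (V i w))\<^sup>2)" if "i \<in> I" for i
    using that D2 by (auto simp: V_def I_def power_mult_distrib power_divide)
  have indD: "P.indep_vars (\<lambda>_. borel) (\<lambda>(l, k). mlp_diff F \<xi> m l k t) I"
    using indep_vars_mlp_diff[OF measurable_F sets_Q Q.prob_space_axioms I(2)] by (simp add: P_def)
  have indV: "P.indep_vars (\<lambda>_. borel) V I"
    using P.indep_vars_compose2[OF indD, of "\<lambda>(l, k) x. (t / real m ^ (n - l)) *\<^sub>R x" "\<lambda>_. borel"]
    by (simp add: V_def split_beta')
  have err: "err n t w = (norm ((\<Sum>i\<in>I. V i w) + (\<xi> - X t)))\<^sup>2" for w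
    unfolding err_def I_def V_def by (subst mlp_eq) (simp add: split_beta' algebra_simps)
  note main = P.indep_vars_norm_affine_square_le[OF I(1) indV V2, of "\<xi> - X t"]
  show "integrable P (err n t)"
    unfolding err using main(1) by simp

  have "(\<Sum>i\<in>I. (\<integral>w. V i w \<partial>P)) = (\<Sum>(l, k)\<in>I. (t / real m ^ (n - l)) *\<^sub>R (A l - (if l = 0 then 0 else A (l - 1))))"
    by (intro sum.cong refl) (auto simp: V_def I_def ED)
  also have "\<dots> = (\<Sum>l<n. \<Sum>k\<in>{1..m ^ (n - l)}. (t / real m ^ (n - l)) *\<^sub>R (A l - (if l = 0 then 0 else A (l - 1))))"
    unfolding I_def by (subst sum.Sigma) auto
  also have "\<dots> = (\<Sum>l<n. t *\<^sub>R (A l - (if l = 0 then 0 else A (l - 1))))"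
    using m_pos by (intro sum.cong refl) (simp add: sum_constant_scaleR)
  also have "\<dots> = t *\<^sub>R (\<Sum>l<n. A l - (if l = 0 then 0 else A (l - 1)))"
    by (simp add: scaleR_sum_right)
  also have "(\<Sum>l<n. A l - (if l = 0 then 0 else A (l - 1))) = A (n - 1)"
    using n by (induction n rule: dec_induct) (auto simp: lessThan_Suc)
  finally have EV: "(\<Sum>i\<in>I. (\<integral>w. V i w \<partial>P)) = t *\<^sub>R A (n - 1)" .
  have "(\<lambda>q. case_prod F (X (snd q * t), fst q)) \<in> borel_measurable (\<mu> \<Otimes>\<^sub>M borel)" by measurable
  then have "(\<lambda>q. F (X (snd q * t)) (fst q)) \<in> borel_measurable Q"
    by (simp add: measurable_cong_sets[OF sets_Q refl])
  from integral_R_fst[OF this] have XR: "X t = \<xi> + t *\<^sub>R (\<integral>x. hX x \<partial>R)"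
    using X_eq[OF t] by (simp add: hX_def Q_def)
  \<comment> \<open>The exact equation has the same form as the telescoped mean, so the bias is
    \<open>t\<close> times a mean of \<open>h (n - 1) - hX\<close>, ready for the second-moment
    bound and the Lipschitz condition.\<close>
  have "t *\<^sub>R A (n - 1) + (\<xi> - X t) = t *\<^sub>R (\<integral>x. h (n - 1) x - hX x \<partial>R)"
    using n hX_int h_int[of "n - 1"] by (simp add: XR A_def scaleR_diff_right)
  then have "(norm (t *\<^sub>R A (n - 1) + (\<xi> - X t)))\<^sup>2 = t\<^sup>2 * (norm (\<integral>x. h (n - 1) x - hX x \<partial>R))\<^sup>2"
    by (simp add: power_mult_distrib)
  also have "\<dots> \<le> t\<^sup>2 * (\<integral>x. (norm (h (n - 1) x - hX x))\<^sup>2 \<partial>R)"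
    using n hhX_sq by (intro mult_left_mono R.norm_expectation_square_le) auto
  also have "\<dots> \<le> t\<^sup>2 * (\<integral>x. L\<^sup>2 * err_R (n - 1) t x \<partial>R)"
    using n hhX_sq S hhX by (intro mult_left_mono integral_mono) auto
  also have "\<dots> = t\<^sup>2 * L\<^sup>2 * mean_err (n - 1) t"
    by (simp add: mean_err_def)
  finally have bias: "(norm (t *\<^sub>R A (n - 1) + (\<xi> - X t)))\<^sup>2 \<le> t\<^sup>2 * L\<^sup>2 * mean_err (n - 1) t" .

  have "(\<Sum>i\<in>I. (\<integral>w. (norm (V i w))\<^sup>2 \<partial>P)) \<le> (\<Sum>(l, k)\<in>I. (t / real m ^ (n - l))\<^sup>2 * B l)"
  proof (rule sum_mono, safe)
    fix l k assume "(l, k) \<in> I"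
    then have "l < n" by (simp add: I_def)
    then show "(\<integral>w. (norm (V (l, k) w))\<^sup>2 \<partial>P) \<le> (t / real m ^ (n - l))\<^sup>2 * B l"
      using mult_left_mono[OF conjunct2[OF D2[of l k]], of "(t / real m ^ (n - l))\<^sup>2"]
      by (simp add: V_def power_mult_distrib power_divide)
  qed
  also have "\<dots> = (\<Sum>l<n. \<Sum>k\<in>{1..m ^ (n - l)}. (t / real m ^ (n - l))\<^sup>2 * B l)"
    unfolding I_def by (subst sum.Sigma) auto
  also have "\<dots> = (\<Sum>l<n. t\<^sup>2 / real m ^ (n - l) * B l)"
    using m_pos by (intro sum.cong refl) (simp add: power2_eq_square)
  finally show "(\<integral>w. err n t w \<partial>P) \<le>
      (\<Sum>l<n. t\<^sup>2 / real m ^ (n - l) * (if l = 0 then K else 2 * L\<^sup>2 * (mean_err l t + mean_err (l - 1) t)))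
        + t\<^sup>2 * L\<^sup>2 * mean_err (n - 1) t"
    using main(2) bias unfolding err EV B_def by linarith
qed

text \<open>The two lower bounds on \<open>D\<close> serve the level-0 samples and the start
  \<open>n = 0\<close>, where the approximation is \<open>\<xi>\<close>. In \<open>\<kappa>\<close>
  the number 7 collects 6 from the variances and 1 from the bias; the summand 1 keeps
  \<open>\<kappa>\<close> positive when \<open>T\<close> or \<open>L\<close> vanishes. This gives
  \<open>7 * y \<le> E - 1\<close>, and the inductive bound closes because
  \<open>1 + (E - 1) * 2 ^ n'\<close> is at most \<open>2 ^ n' * E\<close>.\<close>

lemma mlp_error:
  assumes D: "T\<^sup>2 * K \<le> D" "\<And>t. t \<in> {0..T} \<Longrightarrow> (norm (\<xi> - X t))\<^sup>2 \<le> D"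
  defines "\<kappa> \<equiv> 7 * T * L\<^sup>2 + 1"
  shows "err_le n (D * 2 ^ n / real m ^ n) (\<kappa> * real m)"
proof (induction n rule: less_induct)
  case (less n)
  have \<kappa>: "\<kappa> > 0" using T_nonneg by (auto simp: \<kappa>_def intro!: add_nonneg_pos)
  then have c: "\<kappa> * real m > 0" using m_pos by simp
  have D0: "0 \<le> D" using order_trans[OF zero_le_power2 D(2)[of 0]] T_nonneg by simp
  show ?case
  proof (cases n)
    case 0
    have "(\<integral>w. err 0 t w \<partial>P) \<le> D * exp (\<kappa> * real m * t)" if "t \<in> {0..T}" for t
    proof -
      have "(\<integral>w. err 0 t w \<partial>P) = (norm (\<xi> - X t))\<^sup>2 * 1"
        by (simp add: err_def mlp_0 P.prob_space)
      also have "\<dots> \<le> D * exp (\<kappa> * real m * t)"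
        using D(2)[OF that] D0 that c by (intro mult_mono) auto
      finally show ?thesis .
    qed
    then show ?thesis by (auto simp: 0 err_le_def err_def[abs_def] mlp_0)
  next
    case (Suc n')
    show ?thesis
      unfolding err_le_def
    proof safe
      fix t assume t: "t \<in> {0..T}"
      let ?c = "\<kappa> * real m"
      define j where "j = exp_mean ?c t"
      define E where "E = exp (?c * t)"
      \<comment> \<open>\<open>D / m ^ n * y\<close> is the common unit of all Lipschitz
        contributions. The factor \<open>m\<close> in it is the loss from using lower-level errors,
        and it cancels against \<open>t * j = (E - 1) / (\<kappa> * m)\<close>.\<close>
      define y where "y = t\<^sup>2 * j * real m * L\<^sup>2"
      have rec: "l < n \<Longrightarrow> err_le l (D * 2 ^ l / real m ^ l) ?c" for l
        using less.IH by simp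
      have nn: "0 \<le> D * 2 ^ l / real m ^ l" for l using D0 by simp
      have S: "mean_err l t \<le> D * 2 ^ l / real m ^ l * j" if "l < n" for l
        using err_R_le(2)[OF rec[OF that] nn c t] by (simp add: mean_err_def j_def)
      note main = mlp_recursion[of n "\<lambda>l. D * 2 ^ l / real m ^ l", OF _ nn c rec t]
      show "integrable P (err n t)" using main(1) Suc by simp
      have j0: "j \<ge> 0" unfolding j_def using c t by (intro exp_mean_nonneg) auto
      have E1: "E \<ge> 1" using c t by (simp add: E_def)
      have "y = t * (t * j) * real m * L\<^sup>2" by (simp add: y_def power2_eq_square)
      also have "\<dots> = t * L\<^sup>2 * ((E - 1) / \<kappa>)"
        unfolding j_def mult_exp_mean[OF c] E_def using m_pos \<kappa> by (simp add: field_simps)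
      also have "\<dots> \<le> T * L\<^sup>2 * ((E - 1) / \<kappa>)"
        using t E1 \<kappa> by (intro mult_right_mono) auto
      finally have "7 * y \<le> 7 * (T * L\<^sup>2 * ((E - 1) / \<kappa>))" by simp
      also have "\<dots> = (7 * T * L\<^sup>2 / \<kappa>) * (E - 1)" by simp
      also have "\<dots> \<le> 1 * (E - 1)"
        using E1 \<kappa> by (intro mult_right_mono) (auto simp: \<kappa>_def)
      finally have y: "7 * y \<le> E - 1" by simp
      have mp: "real m ^ a > 0" for a using m_pos by simp
      have "t\<^sup>2 * K \<le> T\<^sup>2 * K"
        using t by (intro mult_right_mono power_mono) (auto simp: K_def)
      then have t0: "t\<^sup>2 / real m ^ n * K \<le> D / real m ^ n"
        using D(1) mp by (simp add: divide_right_mono)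
      \<comment> \<open>The 6 is the 2 from the square of a difference times the 3 from
        \<open>2 + m \<le> 3 * m\<close>, where 2 stands for level \<open>Suc l\<close> and
        \<open>m\<close> for the coarser level \<open>l\<close>.\<close>
      have summand: "t\<^sup>2 / real m ^ (n - Suc l) * (2 * L\<^sup>2 * (mean_err (Suc l) t + mean_err l t))
         \<le> D / real m ^ n * (6 * y * 2 ^ l)" if l: "l < n'" for l
      proof -
        have "mean_err (Suc l) t + mean_err l t \<le> D * 2 ^ Suc l / real m ^ Suc l * j + D * 2 ^ l / real m ^ l * j"
          using l Suc by (intro add_mono S) auto
        also have "\<dots> = D * 2 ^ l * j * (2 + real m) / real m ^ Suc l"
          using m_pos by (simp add: field_simps)
        also have "\<dots> \<le> D * 2 ^ l * j * (3 * real m) / real m ^ Suc l"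
          using D0 j0 m_pos by (intro divide_right_mono mult_left_mono) auto
        finally have "t\<^sup>2 / real m ^ (n - Suc l) * (2 * L\<^sup>2 * (mean_err (Suc l) t + mean_err l t))
           \<le> t\<^sup>2 / real m ^ (n - Suc l) * (2 * L\<^sup>2 * (D * 2 ^ l * j * (3 * real m) / real m ^ Suc l))"
          by (intro mult_left_mono) auto
        also have "\<dots> = D * (6 * y * 2 ^ l) / (real m ^ (n - Suc l) * real m ^ Suc l)"
          by (simp add: y_def ac_simps)
        also have "real m ^ (n - Suc l) * real m ^ Suc l = real m ^ n"
          using l Suc by (simp flip: power_add)
        finally show ?thesis by simp
      qed
      have "t\<^sup>2 * L\<^sup>2 * mean_err n' t \<le> t\<^sup>2 * L\<^sup>2 * (D * 2 ^ n' / real m ^ n' * j)"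
        using Suc by (intro mult_left_mono S) auto
      also have "\<dots> = D / real m ^ n * (y * 2 ^ n')"
        using m_pos by (simp add: y_def Suc field_simps)
      finally have tb: "t\<^sup>2 * L\<^sup>2 * mean_err n' t \<le> D / real m ^ n * (y * 2 ^ n')" .
      have geom: "(\<Sum>l<n'. (2::real) ^ l) = 2 ^ n' - 1"
        by (induction n') auto
      have "(\<integral>w. err n t w \<partial>P) \<le> t\<^sup>2 / real m ^ n * K +
          (\<Sum>l<n'. t\<^sup>2 / real m ^ (n - Suc l) * (2 * L\<^sup>2 * (mean_err (Suc l) t + mean_err l t))) + t\<^sup>2 * L\<^sup>2 * mean_err n' t"
        using main(2) unfolding Suc by (simp add: sum.lessThan_Suc_shift del: sum.lessThan_Suc)
      also have "\<dots> \<le> D / real m ^ n + (\<Sum>l<n'. D / real m ^ n * (6 * y * 2 ^ l)) + D / real m ^ n * (y * 2 ^ n')"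
        using t0 tb by (intro add_mono sum_mono summand) auto
      also have "\<dots> = D / real m ^ n * (1 + 6 * y * (2 ^ n' - 1) + y * 2 ^ n')"
        unfolding geom[symmetric] by (simp add: sum_distrib_left algebra_simps)
      also have "\<dots> \<le> D / real m ^ n * (2 ^ n * E)"
      proof (rule mult_left_mono)
        have y0: "y \<ge> 0" using j0 by (simp add: y_def)
        have "1 + 6 * y * (2 ^ n' - 1) + y * 2 ^ n' \<le> 1 + 7 * y * 2 ^ n'"
          using y0 by (simp add: algebra_simps)
        also have "\<dots> \<le> 1 + (E - 1) * 2 ^ n'"
          using y by simp
        also have "\<dots> \<le> 2 ^ n' * E"
          using one_le_power[of "2::real" n'] by (simp add: algebra_simps)
        also have "\<dots> \<le> 2 ^ n * E" using E1 by (simp add: Suc)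
        finally show "1 + 6 * y * (2 ^ n' - 1) + y * 2 ^ n' \<le> 2 ^ n * E" .
      qed (use D0 in simp)
      finally show "(\<integral>w. err n t w \<partial>P) \<le> D * 2 ^ n / real m ^ n * exp (?c * t)"
        by (simp add: E_def)
    qed
  qed
qed

end

section \<open>Cost\<close>

text \<open>If \<open>N\<close> is the least admissible level and exceeds 1, its predecessor still
  has squared error above \<open>\<epsilon>\<^sup>2\<close>, so
  \<open>\<epsilon> powr (2 + \<delta>)\<close> is below that squared error to the power
  \<open>1 + \<delta> / 2\<close>. Multiplied by the cost, it leaves a sequence tending to 0,
  because the surplus \<open>\<delta> / 2\<close> yields a decay of order
  \<open>n powr (- \<delta> * n / 2)\<close> that beats every exponential factor.\<close>

lemma exists_level_error_cost:
  fixes D \<beta> \<delta> :: real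
  assumes D: "0 < D" and \<beta>: "0 < \<beta>" and \<delta>: "0 < \<delta>"
  shows "\<exists>(c::real) (N :: real \<Rightarrow> nat). \<forall>\<epsilon>\<in>{0<..1}.
    N \<epsilon> \<ge> 1 \<and> (5 * real (N \<epsilon>)) ^ N \<epsilon> \<le> c * \<epsilon> powr (- (2 + \<delta>)) \<and> D * (\<beta> / real (N \<epsilon>)) ^ N \<epsilon> \<le> \<epsilon>\<^sup>2"
proof -
  define a where "a n = D * (\<beta> / real n) ^ n" for n
  \<comment> \<open>By minimality of \<open>N \<epsilon>\<close>, the normalized cost is at most \<open>g (N \<epsilon> - 1)\<close>.\<close>
  define g where "g n = (5 * real (Suc n)) ^ Suc n * a n powr (1 + \<delta> / 2)" for n
  have a_pos: "a n > 0" if "n > 0" for n using that D \<beta> by (simp add: a_def)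
  \<comment> \<open>This is \<open>g\<close> in logarithmic form with a real argument. The terms of
    order \<open>x * ln x\<close> have total coefficient \<open>- \<delta> / 2\<close>, and all
    others are of lower order.\<close>
  have "((\<lambda>x::real. exp ((x + 1) * ln (5 * (x + 1)) + (1 + \<delta> / 2) * (ln D + x * (ln \<beta> - ln x)))) \<longlongrightarrow> 0) at_top"
    using \<delta> by real_asymp
  then have lim: "(\<lambda>n::nat. exp ((real n + 1) * ln (5 * (real n + 1)) + (1 + \<delta> / 2) * (ln D + real n * (ln \<beta> - ln (real n))))) \<longlonglongrightarrow> 0"
    by (rule filterlim_compose[OF _ filterlim_real_sequentially])
  have geq: "g n = exp ((real n + 1) * ln (5 * (real n + 1)) + (1 + \<delta> / 2) * (ln D + real n * (ln \<beta> - ln (real n))))"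
    if "n > 0" for n
  proof -
    have "ln (a n) = ln D + real n * (ln \<beta> - ln (real n))"
      using that D \<beta> by (simp add: a_def ln_mult ln_div ln_realpow)
    then have 1: "a n powr (1 + \<delta> / 2) = exp ((1 + \<delta> / 2) * (ln D + real n * (ln \<beta> - ln (real n))))"
      using a_pos[OF that] by (simp add: powr_def)
    have "(5 * real (Suc n)) ^ Suc n = (5 * real (Suc n)) powr real (Suc n)"
      by (rule powr_realpow[symmetric]) simp
    also have "\<dots> = exp ((real n + 1) * ln (5 * (real n + 1)))"
      by (simp add: powr_def add.commute)
    finally show ?thesis unfolding g_def 1 by (simp add: exp_add)
  qed
  have "g \<longlonglongrightarrow> 0"
    by (rule Lim_transform_eventually[OF lim])
      (use geq in \<open>auto intro: eventually_mono[OF eventually_gt_at_top[of 0]]\<close>)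
  then obtain c where c: "\<bar>g n\<bar> \<le> c" for n
    using convergent_imp_Bseq[of g] by (auto simp: convergent_def Bseq_def)
  have "((\<lambda>x::real. exp (ln D + x * (ln \<beta> - ln x))) \<longlongrightarrow> 0) at_top"
    by real_asymp
  then have lim': "(\<lambda>n::nat. exp (ln D + real n * (ln \<beta> - ln (real n)))) \<longlonglongrightarrow> 0"
    by (rule filterlim_compose[OF _ filterlim_real_sequentially])
  have a_lim: "a \<longlonglongrightarrow> 0"
  proof (rule Lim_transform_eventually[OF lim'])
    show "\<forall>\<^sub>F n in sequentially. exp (ln D + real n * (ln \<beta> - ln (real n))) = a n"
      using eventually_gt_at_top[of 0]
    proof eventually_elim
      case (elim n)
      then have "ln (a n) = ln D + real n * (ln \<beta> - ln (real n))"
        using D \<beta> by (simp add: a_def ln_mult ln_div ln_realpow)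
      then show ?case using a_pos[OF elim] by (metis exp_ln)
    qed
  qed
  have ex: "\<exists>n. n \<ge> 1 \<and> a n \<le> \<epsilon>\<^sup>2" if "\<epsilon> \<in> {0<..1}" for \<epsilon>
  proof -
    have "\<forall>\<^sub>F n in sequentially. a n < \<epsilon>\<^sup>2"
      using that by (intro order_tendstoD(2)[OF a_lim]) auto
    then have "\<forall>\<^sub>F n in sequentially. n \<ge> 1 \<and> a n \<le> \<epsilon>\<^sup>2"
      using eventually_ge_at_top[of 1] by eventually_elim auto
    from eventually_happens'[OF sequentially_bot this] show ?thesis .
  qed
  define N where "N \<epsilon> = (LEAST n. n \<ge> 1 \<and> a n \<le> \<epsilon>\<^sup>2)" for \<epsilon>
  have N: "N \<epsilon> \<ge> 1 \<and> a (N \<epsilon>) \<le> \<epsilon>\<^sup>2" if "\<epsilon> \<in> {0<..1}" for \<epsilon>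
    unfolding N_def by (rule LeastI_ex[OF ex[OF that]])
  \<comment> \<open>The bound \<open>c\<close> on \<open>g\<close> covers levels that have a
    predecessor; the added 5 is the cost at level 1, where there is none.\<close>
  have "(5 * real (N \<epsilon>)) ^ N \<epsilon> \<le> (5 + c) * \<epsilon> powr (- (2 + \<delta>))" if \<epsilon>: "\<epsilon> \<in> {0<..1}" for \<epsilon>
  proof -
    have c0: "c \<ge> 0" using c[of 0] by linarith
    have "(5 * real (N \<epsilon>)) ^ N \<epsilon> * \<epsilon> powr (2 + \<delta>) \<le> 5 + c"
    proof (cases "N \<epsilon> = 1")
      case True
      have "\<epsilon> powr (2 + \<delta>) \<le> 1" using \<epsilon> \<delta> by (intro powr_le1) auto
      then show ?thesis using c0 True by simp
    next
      case False
      define n where "n = N \<epsilon> - 1"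
      have n: "n \<ge> 1" "N \<epsilon> = Suc n" using N[OF \<epsilon>] False by (auto simp: n_def)
      have "\<epsilon>\<^sup>2 < a n"
        using not_less_Least[of n "\<lambda>n. n \<ge> 1 \<and> a n \<le> \<epsilon>\<^sup>2"] n by (auto simp: N_def)
      then have "(\<epsilon>\<^sup>2) powr (1 + \<delta> / 2) \<le> a n powr (1 + \<delta> / 2)"
        using \<delta> by (intro powr_mono2) auto
      moreover have "(\<epsilon>\<^sup>2) powr (1 + \<delta> / 2) = \<epsilon> powr (2 + \<delta>)"
        using \<epsilon> by (simp add: powr_powr algebra_simps flip: powr_numeral)
      ultimately have "(5 * real (N \<epsilon>)) ^ N \<epsilon> * \<epsilon> powr (2 + \<delta>) \<le> g n"
        unfolding g_def n by (intro mult_left_mono) auto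
      then show ?thesis using c[of n] by linarith
    qed
    then show ?thesis
      using \<epsilon> by (subst powr_minus) (simp add: field_simps)
  qed
  with N show ?thesis
    unfolding a_def by blast
qed

text \<open>Each bracket has three terms, all at most \<open>(5 * m) ^ l\<close>. After extracting
  \<open>m ^ n\<close> the induction closes because the base 5 is large enough for one plus the
  geometric sum with coefficient 3 to stay below \<open>5 ^ n\<close>.\<close>

lemma RV_le_power:
  fixes RV :: "nat \<Rightarrow> nat \<Rightarrow> nat"
  assumes "m \<ge> 1" and "RV 0 m = 0"
    and rec: "\<And>n. n \<ge> 1 \<Longrightarrow>
      RV n m \<le> m ^ n + (\<Sum>l\<in>{1..<n}. m ^ (n - l) * (1 + RV l m + RV (l - 1) m))"
  shows "RV n m \<le> (5 * m) ^ n"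
proof (induction n rule: less_induct)
  case (less n)
  show ?case
  proof (cases n)
    case 0
    then show ?thesis using assms by simp
  next
    case (Suc n')
    have geom: "1 + (\<Sum>l<n'. 3 * (5::nat) ^ Suc l) \<le> 5 ^ Suc n'"
      by (induction n') auto
    have "m ^ (n - l) * (1 + RV l m + RV (l - 1) m) \<le> m ^ n * (3 * 5 ^ l)" if l: "l \<in> {1..<n}" for l
    proof -
      have "RV (l - 1) m \<le> (5 * m) ^ (l - 1)" using l by (intro less.IH) auto
      also have "\<dots> \<le> (5 * m) ^ l" using assms(1) by (intro power_increasing) auto
      finally have "RV (l - 1) m \<le> (5 * m) ^ l" .
      moreover have "RV l m \<le> (5 * m) ^ l" using l by (intro less.IH) auto
      moreover have "1 \<le> (5 * m) ^ l" using assms(1) by (intro one_le_power) simp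
      ultimately have "1 + RV l m + RV (l - 1) m \<le> 3 * (5 * m) ^ l" by linarith
      then have "m ^ (n - l) * (1 + RV l m + RV (l - 1) m) \<le> m ^ (n - l) * (3 * (5 * m) ^ l)"
        by (rule mult_left_mono) simp
      also have "\<dots> = (m ^ (n - l) * m ^ l) * (3 * 5 ^ l)"
        by (simp add: power_mult_distrib)
      also have "m ^ (n - l) * m ^ l = m ^ n"
        using l by (simp flip: power_add)
      finally show ?thesis .
    qed
    then have "RV n m \<le> m ^ n + (\<Sum>l\<in>{1..<n}. m ^ n * (3 * 5 ^ l))"
      using rec[of n] Suc by (intro order_trans[OF rec] add_left_mono sum_mono) auto
    also have "\<dots> = m ^ n * (1 + (\<Sum>l\<in>{1..<n}. 3 * 5 ^ l))"
      by (simp add: sum_distrib_left algebra_simps)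
    also have "(\<Sum>l\<in>{1..<n}. 3 * (5::nat) ^ l) = (\<Sum>l<n'. 3 * 5 ^ Suc l)"
      using sum.shift_bounds_Suc_ivl[of "\<lambda>l. 3 * (5::nat) ^ l" 0 n'] by (simp add: Suc atLeast0LessThan)
    also have "m ^ n * (1 + (\<Sum>l<n'. 3 * (5::nat) ^ Suc l)) \<le> m ^ n * 5 ^ Suc n'"
      using geom by (rule mult_left_mono) simp
    also have "\<dots> = (5 * m) ^ n" by (simp add: Suc power_mult_distrib)
    finally show ?thesis .
  qed
qed

section \<open>Transfer to the given random variables\<close>

text \<open>Expanding in the basis bounds \<open>\<nu>\<close> from above, which makes it Lipschitz
  and so continuous; its minimum on the compact unit sphere is positive and gives the other bound by
  homogeneity. Continuity is returned as well, since it yields Borel measurability of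
  \<open>\<nu>\<close>.\<close>

lemma is_norm_equivalent:
  fixes \<nu> :: "'a :: euclidean_space \<Rightarrow> real"
  assumes "is_norm \<nu>"
  obtains a b where "a > 0" "b > 0" "\<And>x. norm x \<le> a * \<nu> x" "\<And>x. \<nu> x \<le> b * norm x" "continuous_on UNIV \<nu>"
proof -
  have \<nu>: "0 \<le> \<nu> x" "\<nu> x = 0 \<longleftrightarrow> x = 0" "\<nu> (r *\<^sub>R x) = \<bar>r\<bar> * \<nu> x" "\<nu> (x + y) \<le> \<nu> x + \<nu> y" for r x y
    using assms by (auto simp: is_norm_def)
  define b where "b = (\<Sum>i\<in>Basis. \<nu> i) + 1"
  have sum_le: "\<nu> (\<Sum>i\<in>I. f i) \<le> (\<Sum>i\<in>I. \<nu> (f i))" if "finite I" for I and f :: "'a \<Rightarrow> 'a"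
    using that
  proof induction
    case empty
    then show ?case using \<nu>(2)[of 0] by simp
  next
    case (insert i I)
    then show ?case using \<nu>(4)[of "f i" "sum f I"] by simp
  qed
  have b: "b > 0" unfolding b_def by (intro add_nonneg_pos sum_nonneg \<nu>) auto
  have up: "\<nu> x \<le> b * norm x" for x
  proof -
    have "\<nu> x = \<nu> (\<Sum>i\<in>Basis. (x \<bullet> i) *\<^sub>R i)" by (simp add: euclidean_representation)
    also have "\<dots> \<le> (\<Sum>i\<in>Basis. \<bar>x \<bullet> i\<bar> * \<nu> i)" using sum_le[of Basis "\<lambda>i. (x \<bullet> i) *\<^sub>R i"] by (simp add: \<nu>(3))
    also have "\<dots> \<le> (\<Sum>i\<in>Basis. norm x * \<nu> i)" by (intro sum_mono mult_right_mono Basis_le_norm \<nu>)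
    also have "\<dots> \<le> b * norm x" by (simp add: b_def algebra_simps flip: sum_distrib_left)
    finally show ?thesis .
  qed
  have diff: "\<bar>\<nu> x - \<nu> y\<bar> \<le> b * norm (x - y)" for x y
    using \<nu>(4)[of "x - y" y] \<nu>(4)[of "y - x" x] up[of "x - y"] up[of "y - x"] by (simp add: norm_minus_commute abs_le_iff)
  have "b-lipschitz_on UNIV \<nu>"
    by (rule lipschitz_onI) (use diff b in \<open>auto simp: dist_norm\<close>)
  then have cont: "continuous_on UNIV \<nu>"
    by (rule lipschitz_on_continuous_on)
  obtain e :: 'a where "e \<in> Basis" using nonempty_Basis by blast
  then have "sphere (0::'a) 1 \<noteq> {}" by (auto simp: norm_Basis intro!: exI[of _ e])
  then obtain x0 where x0: "x0 \<in> sphere 0 1" "\<And>y. y \<in> sphere 0 1 \<Longrightarrow> \<nu> x0 \<le> \<nu> y"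
    using continuous_attains_inf[OF compact_sphere _ continuous_on_subset[OF cont subset_UNIV]] by blast
  have pos: "\<nu> x0 > 0" using x0(1) \<nu>(1)[of x0] \<nu>(2)[of x0] by (cases "x0 = 0") auto
  have low: "norm x \<le> (1 / \<nu> x0) * \<nu> x" for x
  proof (cases "x = 0")
    case False
    have "\<nu> x0 \<le> \<nu> ((1 / norm x) *\<^sub>R x)" using False by (intro x0) simp
    also have "\<dots> = \<nu> x / norm x" by (simp add: \<nu>(3))
    finally show ?thesis using False pos by (simp add: field_simps)
  qed (use \<nu>(1)[of x] pos in auto)
  show ?thesis
    by (rule that[of "1 / \<nu> x0" b]) (use pos b low up cont in auto)
qed

section \<open>Joint law of the pairs of samples and random times\<close>

lemma Int_stable_vimage: "Int_stable {f -` A \<inter> \<Omega> |A. A \<in> sets N}"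
proof (rule Int_stableI, safe)
  fix A B assume "A \<in> sets N" "B \<in> sets N"
  then show "\<exists>C. f -` A \<inter> \<Omega> \<inter> (f -` B \<inter> \<Omega>) = f -` C \<inter> \<Omega> \<and> C \<in> sets N"
    by (intro exI[of _ "A \<inter> B"]) auto
qed

lemma vimage_in_vimage_algebra_PiM:
  assumes f: "\<And>i. i \<in> I \<Longrightarrow> f i \<in> M \<rightarrow>\<^sub>M N" and i: "i \<in> I" and A: "A \<in> sets N"
  shows "f i -` A \<inter> space M \<in> sets (vimage_algebra (space M) (\<lambda>\<omega>. \<lambda>i\<in>I. f i \<omega>) (PiM I (\<lambda>_. N)))"
proof -
  have "(\<lambda>\<omega>. \<lambda>i\<in>I. f i \<omega>) \<in> space M \<rightarrow> space (PiM I (\<lambda>_. N))"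
    using f[THEN measurable_space] by (auto simp: space_PiM)
  from measurable_compose[OF measurable_vimage_algebra1[OF this] measurable_component_singleton[OF i]]
  have "f i \<in> vimage_algebra (space M) (\<lambda>\<omega>. \<lambda>i\<in>I. f i \<omega>) (PiM I (\<lambda>_. N)) \<rightarrow>\<^sub>M N"
    using i by simp
  from measurable_sets[OF this A] show ?thesis by simp
qed

context prob_space
begin

text \<open>Independence of the two families gives the product formula on rectangles, which
  determine the pair measure.\<close>

lemma indep_families_distr_Pair:
  assumes rv: "\<And>i. i \<in> I \<Longrightarrow> Z i \<in> M \<rightarrow>\<^sub>M S" "\<And>i. i \<in> I \<Longrightarrow> r i \<in> M \<rightarrow>\<^sub>M N"
    and ind: "indep_families M N r I S Z I" and i: "i \<in> I"
  shows "distr M (S \<Otimes>\<^sub>M N) (\<lambda>\<omega>. (Z i \<omega>, r i \<omega>)) = distr M S (Z i) \<Otimes>\<^sub>M distr M N (r i)"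
proof (rule pair_measure_eqI[symmetric])
  note [measurable] = rv(1)[OF i] rv(2)[OF i]
  interpret Z: prob_space "distr M S (Z i)" by (rule prob_space_distr) simp
  interpret r: prob_space "distr M N (r i)" by (rule prob_space_distr) simp
  show "sigma_finite_measure (distr M S (Z i))" "sigma_finite_measure (distr M N (r i))" ..
  show "sets (distr M S (Z i) \<Otimes>\<^sub>M distr M N (r i)) = sets (distr M (S \<Otimes>\<^sub>M N) (\<lambda>\<omega>. (Z i \<omega>, r i \<omega>)))"
    by (simp cong: sets_pair_measure_cong)
  fix A B assume A: "A \<in> sets (distr M S (Z i))" and B: "B \<in> sets (distr M N (r i))"
  let ?A = "Z i -` A \<inter> space M" and ?B = "r i -` B \<inter> space M"
  have "prob (?B \<inter> ?A) = prob ?B * prob ?A"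
    by (rule indep_setD[OF ind[unfolded indep_families_def]])
      (use A B rv i in \<open>auto intro!: vimage_in_vimage_algebra_PiM\<close>)
  moreover have "(\<lambda>\<omega>. (Z i \<omega>, r i \<omega>)) -` (A \<times> B) \<inter> space M = ?B \<inter> ?A" by auto
  ultimately show "emeasure (distr M S (Z i)) A * emeasure (distr M N (r i)) B =
      emeasure (distr M (S \<Otimes>\<^sub>M N) (\<lambda>\<omega>. (Z i \<omega>, r i \<omega>))) (A \<times> B)"
    using A B by (simp add: emeasure_distr emeasure_eq_measure ennreal_mult mult.commute)
qed

text \<open>All events of both families are put into one system indexed by pairs
  \<open>(i, b)\<close>, with \<open>b\<close> selecting the family. A finite intersection splits
  into an event of \<open>Z\<close> and an event of \<open>r\<close>; these are independent of each
  other, and each factors within its own family. Regrouping by \<open>i\<close> then gives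
  independence of the pairs.\<close>

lemma indep_vars_Pair:
  fixes I :: "'i set"
  assumes Z: "indep_vars (\<lambda>_. S) Z I" and r: "indep_vars (\<lambda>_. N) r I"
    and ind: "indep_families M N r I S Z I"
  shows "indep_vars (\<lambda>_. S \<Otimes>\<^sub>M N) (\<lambda>i \<omega>. (Z i \<omega>, r i \<omega>)) I"
proof -
  let ?VZ = "vimage_algebra (space M) (\<lambda>\<omega>. \<lambda>i\<in>I. Z i \<omega>) (PiM I (\<lambda>_. S))"
  let ?Vr = "vimage_algebra (space M) (\<lambda>\<omega>. \<lambda>i\<in>I. r i \<omega>) (PiM I (\<lambda>_. N))"
  have rvZ: "Z i \<in> M \<rightarrow>\<^sub>M S" and rvr: "r i \<in> M \<rightarrow>\<^sub>M N" if "i \<in> I" for i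
    using Z r that by (auto simp: indep_vars_def)
  define G where "G = (\<lambda>(i, b). if b then {Z i -` A \<inter> space M |A. A \<in> sets S} else {r i -` A \<inter> space M |A. A \<in> sets N})"
  have GZ: "G (i, True) \<subseteq> sets ?VZ" and Gr: "G (i, False) \<subseteq> sets ?Vr" if "i \<in> I" for i
    using vimage_in_vimage_algebra_PiM[of I Z M S, OF rvZ that] vimage_in_vimage_algebra_PiM[of I r M N, OF rvr that]
    by (auto simp: G_def)
  have Gev: "G j \<subseteq> events" if "j \<in> I \<times> UNIV" for j
    using that rvZ rvr by (auto simp: G_def split: if_splits)
  have Gsp: "A \<subseteq> space M" if "A \<in> G j" for A j
    using that by (auto simp: G_def split: prod.splits if_splits)
  have "indep_sets G (I \<times> UNIV)"
    unfolding indep_sets_def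
  proof (intro conjI ballI allI impI)
    fix J A assume J: "J \<subseteq> I \<times> UNIV" "J \<noteq> {}" "finite J" and A: "A \<in> Pi J G"
    define J' where "J' b = {i. (i, b) \<in> J}" for b
    \<comment> \<open>The intersection with \<open>space M\<close> gives the right value when one
      family contributes no event: \<open>E b\<close> is then the whole space, with probability
      1.\<close>
    define E where "E b = space M \<inter> (\<Inter>i\<in>J' b. A (i, b))" for b
    have fin: "finite (J' b)" for b
      unfolding J'_def using finite_imageI[OF J(3), of fst] by (rule rev_finite_subset) force
    have JI: "J' b \<subseteq> I" for b using J(1) by (auto simp: J'_def)
    have AG: "A (i, b) \<in> G (i, b)" if "i \<in> J' b" for i b
      using that A by (auto simp: J'_def)
    have probE: "prob (E b) = (\<Prod>i\<in>J' b. prob (A (i, b)))" for b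
    proof (cases "J' b = {}")
      case True
      then show ?thesis by (simp add: E_def prob_space)
    next
      case False
      have "E b = (\<Inter>i\<in>J' b. A (i, b))"
        using False AG Gsp by (fastforce simp: E_def)
      moreover have "indep_sets (\<lambda>i. G (i, b)) I"
        using Z r by (cases b) (simp_all add: G_def indep_vars_def2)
      ultimately show ?thesis
        using AG JI False fin by (auto simp: indep_sets_def)
    qed
    have EZ: "E True \<in> sets ?VZ"
    proof -
      have "A (i, True) \<in> sets ?VZ" if "i \<in> J' True" for i
        using AG[OF that] GZ[of i] JI[of True] that by blast
      then show ?thesis
        unfolding E_def using fin[of True] sets.top[of ?VZ]
        by (cases "J' True = {}") (auto intro!: sets.Int sets.finite_INT)
    qed
    have Er: "E False \<in> sets ?Vr"
    proof -
      have "A (i, False) \<in> sets ?Vr" if "i \<in> J' False" for i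
        using AG[OF that] Gr[of i] JI[of False] that by blast
      then show ?thesis
        unfolding E_def using fin[of False] sets.top[of ?Vr]
        by (cases "J' False = {}") (auto intro!: sets.Int sets.finite_INT)
    qed
    have J_eq: "J = (\<lambda>i. (i, True)) ` J' True \<union> (\<lambda>i. (i, False)) ` J' False"
    proof (intro set_eqI)
      fix j show "j \<in> J \<longleftrightarrow> j \<in> (\<lambda>i. (i, True)) ` J' True \<union> (\<lambda>i. (i, False)) ` J' False"
        by (cases j; cases "snd j") (auto simp: J'_def image_iff)
    qed
    have "\<exists>j\<in>J. A j \<subseteq> space M" using J A Gsp by blast
    then have "(\<Inter>j\<in>J. A j) = space M \<inter> (\<Inter>j\<in>J. A j)" by blast
    also have "\<dots> = E False \<inter> E True"
      by (subst J_eq) (auto simp: E_def)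
    finally have "prob (\<Inter>j\<in>J. A j) = prob (E False) * prob (E True)"
      using indep_setD[OF ind[unfolded indep_families_def] Er EZ] by simp
    also have "\<dots> = (\<Prod>j\<in>J. prob (A j))"
      unfolding probE
      by (subst J_eq, subst prod.union_disjoint) (auto simp: fin prod.reindex inj_on_def)
    finally show "prob (\<Inter>j\<in>J. A j) = (\<Prod>j\<in>J. prob (A j))" .
  qed (use Gev in auto)
  \<comment> \<open>The generators are stable under intersection, so independence extends to the
    sigma-algebras generated by the two systems of each \<open>i\<close>. Both \<open>Z i\<close>
    and \<open>r i\<close> are measurable for this sigma-algebra, hence so is their pair.\<close>
  then have "indep_sets G (\<Union>i\<in>I. {i} \<times> UNIV)"
    by (rule arg_cong[where f = "indep_sets G", THEN iffD1, rotated]) auto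
  then have "indep_sets (\<lambda>i. sigma_sets (space M) (\<Union>j\<in>{i} \<times> UNIV. G j)) I"
  proof (rule indep_sets_collect_sigma)
    fix i and j :: "'i \<times> bool"
    show "Int_stable (G j)"
      by (cases j) (simp add: G_def Int_stable_vimage)
  qed (auto simp: disjoint_family_on_def)
  then have "indep_sets (\<lambda>i. {(\<lambda>\<omega>. (Z i \<omega>, r i \<omega>)) -` A \<inter> space M |A. A \<in> sets (S \<Otimes>\<^sub>M N)}) I"
  proof (rule indep_sets_mono_sets, safe)
    fix i A assume i: "i \<in> I" and A: "A \<in> sets (S \<Otimes>\<^sub>M N)"
    let ?C = "\<Union>j\<in>{i} \<times> UNIV. G j"
    have C: "?C \<subseteq> Pow (space M)" using Gsp by blast
    have "Z i -` A \<inter> space M \<in> ?C" if "A \<in> sets S" for A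
      by (rule UN_I[of "(i, True)"]) (use that in \<open>auto simp: G_def\<close>)
    moreover have "r i -` A \<inter> space M \<in> ?C" if "A \<in> sets N" for A
      by (rule UN_I[of "(i, False)"]) (use that in \<open>auto simp: G_def\<close>)
    ultimately have "Z i \<in> sigma (space M) ?C \<rightarrow>\<^sub>M S" "r i \<in> sigma (space M) ?C \<rightarrow>\<^sub>M N"
      using rvZ[OF i, THEN measurable_space] rvr[OF i, THEN measurable_space] C
      by (auto intro!: measurableI sigma_sets.Basic simp: sets_measure_of space_measure_of)
    then have "(\<lambda>\<omega>. (Z i \<omega>, r i \<omega>)) \<in> sigma (space M) ?C \<rightarrow>\<^sub>M S \<Otimes>\<^sub>M N"
      by (rule measurable_Pair)
    from measurable_sets[OF this A] C
    show "(\<lambda>\<omega>. (Z i \<omega>, r i \<omega>)) -` A \<inter> space M \<in> sigma_sets (space M) ?C"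
      by (simp add: sets_measure_of space_measure_of)
  qed
  then show ?thesis
    unfolding indep_vars_def2 using rvZ rvr by auto
qed

lemma distr_Pair_PiM:
  assumes Z: "indep_vars (\<lambda>_. S) Z I" and r: "indep_vars (\<lambda>_. N) r I"
    and ind: "indep_families M N r I S Z I"
    and \<mu>: "\<And>i. i \<in> I \<Longrightarrow> distr M S (Z i) = \<mu>" and U: "\<And>i. i \<in> I \<Longrightarrow> distr M N (r i) = U"
    and I: "I \<noteq> {}"
  shows "distr M (PiM I (\<lambda>_. S \<Otimes>\<^sub>M N)) (\<lambda>\<omega>. \<lambda>i\<in>I. (Z i \<omega>, r i \<omega>)) = PiM I (\<lambda>_. \<mu> \<Otimes>\<^sub>M U)"
proof -
  have rvZ: "Z i \<in> M \<rightarrow>\<^sub>M S" and rvr: "r i \<in> M \<rightarrow>\<^sub>M N" if "i \<in> I" for i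
    using Z r that by (auto simp: indep_vars_def)
  have "distr M (S \<Otimes>\<^sub>M N) (\<lambda>\<omega>. (Z i \<omega>, r i \<omega>)) = \<mu> \<Otimes>\<^sub>M U" if "i \<in> I" for i
    using indep_families_distr_Pair[of I Z S r N i] rvZ rvr ind that \<mu>[OF that] U[OF that] by simp
  moreover have "distr M (PiM I (\<lambda>_. S \<Otimes>\<^sub>M N)) (\<lambda>\<omega>. \<lambda>i\<in>I. (Z i \<omega>, r i \<omega>)) =
      PiM I (\<lambda>i. distr M (S \<Otimes>\<^sub>M N) (\<lambda>\<omega>. (Z i \<omega>, r i \<omega>)))"
    using indep_vars_Pair[OF Z r ind]
    by (subst (asm) indep_vars_iff_distr_eq_PiM'[OF I]) (use rvZ rvr in auto)
  ultimately show ?thesis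
    by (simp cong: PiM_cong)
qed

end

section \<open>Random times and identification with the product-space functions\<close>

text \<open>The substitution from \<open>r\<close> to \<open>r * t\<close> turns the integral
  equation into an expectation at a uniform random time, the form that the approximations
  sample.\<close>

lemma scaleR_integral_unif:
  fixes g :: "real \<Rightarrow> 'a :: euclidean_space"
  assumes t: "t > 0" and [measurable]: "g \<in> borel_measurable borel"
  shows "t *\<^sub>R (\<integral>r. g (r * t) \<partial>unif) = (LINT r:{0..t}|lborel. g r)"
proof -
  have "(LINT r:{0..t}|lborel. g r) = t *\<^sub>R (\<integral>r. indicator {0..t} (0 + t * r) *\<^sub>R g (0 + t * r) \<partial>lborel)"
    unfolding set_lebesgue_integral_def
    using lborel_integral_real_affine[of t "\<lambda>r. indicator {0..t} r *\<^sub>R g r" 0] t by simp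
  also have "(\<integral>r. indicator {0..t} (0 + t * r) *\<^sub>R g (0 + t * r) \<partial>lborel) =
      (\<integral>r. indicator {0..1} r *\<^sub>R g (r * t) \<partial>lborel)"
    using t by (intro Bochner_Integration.integral_cong refl)
      (auto simp: indicator_def zero_le_mult_iff mult_le_cancel_left1 mult.commute)
  also have "\<dots> = (\<integral>r. g (r * t) \<partial>unif)"
  proof -
    have "unif = density lborel (\<lambda>r. ennreal (indicator {0..1} r))"
      unfolding uniform_measure_def by (rule density_cong) (auto simp: indicator_def divide_ennreal_def)
    then show ?thesis by (simp add: integral_density)
  qed
  finally show ?thesis by simp
qed

text \<open>A statement about one fixed outcome: the recursion determines each level from lower
  ones, the descendants of a descendant are reached by concatenating prefixes, and the random times
  keep all evaluations inside \<open>{0..T}\<close>. The separate \<open>F \<xi>\<close> term is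
  absorbed as the summand \<open>l = 0\<close>.\<close>

lemma mlp_unique:
  fixes Y :: "int list \<Rightarrow> nat \<Rightarrow> nat \<Rightarrow> real \<Rightarrow> 'w \<Rightarrow> 'a :: euclidean_space"
  assumes r: "\<And>\<theta>. \<theta> \<in> Theta \<Longrightarrow> \<rr> \<theta> \<omega> \<in> {0..1}"
    and Y: "\<And>n \<theta> t. \<theta> \<in> Theta \<Longrightarrow> t \<in> {0..T} \<Longrightarrow>
           Y \<theta> n m t \<omega> =
             (\<Sum>l\<in>{1..<n}. (t / real m ^ (n - l)) *\<^sub>R
                (\<Sum>k\<in>{1..m ^ (n - l)}.
                   F (Y (\<theta> @ [int l, int k]) l m (\<rr> (\<theta> @ [int l, int k]) \<omega> * t) \<omega>)
                     (Z (\<theta> @ [int l, int k]) \<omega>)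
                 - F (Y (\<theta> @ [int l, - int k]) (l - 1) m (\<rr> (\<theta> @ [int l, int k]) \<omega> * t) \<omega>)
                     (Z (\<theta> @ [int l, int k]) \<omega>)))
           + (t * (if n \<ge> 1 then 1 else 0) / real m ^ n) *\<^sub>R
                (\<Sum>k\<in>{1..m ^ n}. F \<xi> (Z (\<theta> @ [0, int k]) \<omega>))
           + \<xi>"
    and "\<theta> \<in> Theta" "t \<in> {0..T}"
  shows "Y \<theta> n m t \<omega> = mlp F \<xi> m n t (subfamily \<theta> (\<lambda>\<eta>. (Z \<eta> \<omega>, \<rr> \<eta> \<omega>)))"
  using assms(3,4)
proof (induction n arbitrary: \<theta> t rule: less_induct)
  case (less n)
  let ?w = "\<lambda>\<theta>. subfamily \<theta> (\<lambda>\<eta>. (Z \<eta> \<omega>, \<rr> \<eta> \<omega>))"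
  have sh: "subfamily p (?w \<theta>) = ?w (\<theta> @ p)" if "p \<noteq> []" for p
    using that by (auto simp: subfamily_def Theta_def)
  have w: "?w \<theta> p = (Z (\<theta> @ p) \<omega>, \<rr> (\<theta> @ p) \<omega>)" if "p \<noteq> []" for p
    using that by (auto simp: subfamily_def Theta_def)
  have IH: "Y (\<theta> @ p) l m (\<rr> (\<theta> @ p') \<omega> * t) \<omega> = mlp F \<xi> m l (\<rr> (\<theta> @ p') \<omega> * t) (?w (\<theta> @ p))"
    if "l < n" "p \<noteq> []" "p' \<noteq> []" for l p p'
  proof (rule less.IH[OF that(1)])
    show "\<theta> @ p \<in> Theta" using that by (simp add: Theta_def)
    have "\<rr> (\<theta> @ p') \<omega> \<in> {0..1}" using that by (intro r) (simp add: Theta_def)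
    then show "\<rr> (\<theta> @ p') \<omega> * t \<in> {0..T}"
      using less.prems(2) mult_mono[of "\<rr> (\<theta> @ p') \<omega>" 1 t T] by auto
  qed
  have IH': "Y (\<theta> @ p) (l - Suc 0) m (\<rr> (\<theta> @ p') \<omega> * t) \<omega> = mlp F \<xi> m (l - Suc 0) (\<rr> (\<theta> @ p') \<omega> * t) (?w (\<theta> @ p))"
    if "l < n" "p \<noteq> []" "p' \<noteq> []" for l p p'
    using that by (intro IH) auto
  show ?case
  proof (cases "n = 0")
    case True
    then show ?thesis using Y[OF less.prems, of n] by (simp add: mlp_0)
  next
    case False
    then have n: "{..<n} = insert 0 {1..<n}" by auto
    show ?thesis
      using False
      by (subst Y[OF less.prems], subst mlp.simps, subst n)
        (simp add: w sh IH IH' mlp_0 scaleR_sum_right)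
  qed
qed

theorem theorem1p1:
  fixes \<delta> T L :: real
    and X :: "real \<Rightarrow> real ^ 'd"
    and \<xi> :: "real ^ 'd"
    and \<nu> :: "real ^ 'd \<Rightarrow> real"
    and S :: "'s measure"
    and F :: "real ^ 'd \<Rightarrow> 's \<Rightarrow> real ^ 'd"
    and M :: "'w measure"
    and Z :: "int list \<Rightarrow> 'w \<Rightarrow> 's"
    and \<rr> :: "int list \<Rightarrow> 'w \<Rightarrow> real"
    and Y :: "int list \<Rightarrow> nat \<Rightarrow> nat \<Rightarrow> real \<Rightarrow> 'w \<Rightarrow> real ^ 'd"
    and RV :: "nat \<Rightarrow> nat \<Rightarrow> nat"
  assumes "0 < \<delta>" and "0 \<le> T" and "0 \<le> L"
    and "continuous_on {0..T} X"
    and "is_norm \<nu>"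
    and "case_prod F \<in> borel \<Otimes>\<^sub>M S \<rightarrow>\<^sub>M borel"
    and "\<And>x y s. s \<in> space S \<Longrightarrow> \<nu> (F x s - F y s) \<le> L * \<nu> (x - y)"
    and "prob_space M"
    and "prob_space.indep_vars M (\<lambda>_. S) Z Theta"
    and "\<And>\<theta>. \<theta> \<in> Theta \<Longrightarrow> distr M S (Z \<theta>) = distr M S (Z [0])"
    and "integrable M (\<lambda>\<omega>. (\<nu> (F \<xi> (Z [0] \<omega>)))\<^sup>2)"
    and "\<And>t. t \<in> {0..T} \<Longrightarrow>
           X t = \<xi> + (LINT r:{0..t}|lborel. (LINT \<omega>|M. F (X r) (Z [0] \<omega>)))"
    and "\<And>\<theta> \<omega>. \<theta> \<in> Theta \<Longrightarrow> \<omega> \<in> space M \<Longrightarrow> \<rr> \<theta> \<omega> \<in> {0..1}"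
    and "prob_space.indep_vars M (\<lambda>_. borel) \<rr> Theta"
    and "\<And>\<theta>. \<theta> \<in> Theta \<Longrightarrow> distr M borel (\<rr> \<theta>) = uniform_measure lborel {0..1}"
    and "indep_families M borel \<rr> Theta S Z Theta"
    and "\<And>n m \<theta> t \<omega>. m \<ge> 1 \<Longrightarrow> \<theta> \<in> Theta \<Longrightarrow> t \<in> {0..T} \<Longrightarrow> \<omega> \<in> space M \<Longrightarrow>
           Y \<theta> n m t \<omega> =
             (\<Sum>l\<in>{1..<n}. (t / real m ^ (n - l)) *\<^sub>R
                (\<Sum>k\<in>{1..m ^ (n - l)}.
                   F (Y (\<theta> @ [int l, int k]) l m (\<rr> (\<theta> @ [int l, int k]) \<omega> * t) \<omega>)
                     (Z (\<theta> @ [int l, int k]) \<omega>)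
                 - F (Y (\<theta> @ [int l, - int k]) (l - 1) m (\<rr> (\<theta> @ [int l, int k]) \<omega> * t) \<omega>)
                     (Z (\<theta> @ [int l, int k]) \<omega>)))
           + (t * (if n \<ge> 1 then 1 else 0) / real m ^ n) *\<^sub>R
                (\<Sum>k\<in>{1..m ^ n}. F \<xi> (Z (\<theta> @ [0, int k]) \<omega>))
           + \<xi>"
    and "\<And>n m. n \<ge> 1 \<Longrightarrow> m \<ge> 1 \<Longrightarrow> RV n m \<ge> 1"
    and "\<And>m. m \<ge> 1 \<Longrightarrow> RV 0 m = 0"
    and "\<And>n m. n \<ge> 1 \<Longrightarrow> m \<ge> 1 \<Longrightarrow>
           RV n m \<le> m ^ n + (\<Sum>l\<in>{1..<n}. m ^ (n - l) * (1 + RV l m + RV (l - 1) m))"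
  shows "\<exists>(c::real) (N :: real \<Rightarrow> nat). \<forall>\<epsilon>\<in>{0<..1}.
           N \<epsilon> \<ge> 1 \<and>
           real (RV (N \<epsilon>) (N \<epsilon>)) \<le> c * \<epsilon> powr (- (2 + \<delta>)) \<and>
           integrable M (\<lambda>\<omega>. (\<nu> (X T - Y [0] (N \<epsilon>) (N \<epsilon>) T \<omega>))\<^sup>2) \<and>
           sqrt (LINT \<omega>|M. (\<nu> (X T - Y [0] (N \<epsilon>) (N \<epsilon>) T \<omega>))\<^sup>2) \<le> \<epsilon>"
proof -
  note T0 = assms(2) and F_meas [measurable] = assms(6) and r01 = assms(13)
  interpret M: prob_space M by fact
  have rvZ: "Z \<theta> \<in> M \<rightarrow>\<^sub>M S" and rvr: "\<rr> \<theta> \<in> M \<rightarrow>\<^sub>M borel" if "\<theta> \<in> Theta" for \<theta>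
    using assms(9,14) that by (auto simp: M.indep_vars_def)
  have Z0 [measurable]: "Z [0] \<in> M \<rightarrow>\<^sub>M S" by (rule rvZ) (simp add: Theta_def)
  obtain a b where ab: "a > 0" "b > 0" "\<And>x. norm x \<le> a * \<nu> x" "\<And>x. \<nu> x \<le> b * norm x"
    and \<nu>_cont: "continuous_on UNIV \<nu>"
    using is_norm_equivalent[OF assms(5)] by blast
  have \<nu>0: "\<nu> x \<ge> 0" for x using assms(5) by (auto simp: is_norm_def)
  have [measurable]: "\<nu> \<in> borel_measurable borel"
    using \<nu>_cont by (rule borel_measurable_continuous_onI)
  define \<mu> where "\<mu> = distr M S (Z [0])"
  interpret \<mu>: prob_space \<mu> unfolding \<mu>_def by (rule M.prob_space_distr) simp
  have sets_\<mu> [measurable_cong]: "sets \<mu> = sets S" by (simp add: \<mu>_def)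
  have space_\<mu>: "space \<mu> = space S" by (simp add: \<mu>_def)
  interpret U: prob_space unif by (rule prob_space_unif)
  interpret \<mu>U: pair_prob_space \<mu> unif ..
  \<comment> \<open>Clamping the time extends \<open>X\<close> continuously to the real line:
    \<open>unif\<close> is a measure on all reals, so evaluations at arbitrary times have to be
    measurable.\<close>
  define X' where "X' r = X (max 0 (min T r))" for r
  have X'_eq: "X' r = X r" if "r \<in> {0..T}" for r using that by (simp add: X'_def)
  have X'_cont: "continuous_on UNIV X'"
    unfolding X'_def
    by (rule continuous_on_compose2[OF assms(4)]) (use T0 in \<open>auto intro!: continuous_intros\<close>)
  have [measurable]: "X' \<in> borel_measurable borel"
    using X'_cont by (rule borel_measurable_continuous_onI)
  have "compact ((\<lambda>r. (norm (\<xi> - X r))\<^sup>2) ` {0..T})"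
    by (intro compact_continuous_image continuous_intros assms) simp
  from bounded_imp_bdd_above[OF compact_imp_bounded[OF this]]
  obtain B where B: "\<And>r. r \<in> {0..T} \<Longrightarrow> (norm (\<xi> - X r))\<^sup>2 \<le> B"
    unfolding bdd_above_def by blast
  have B': "(norm (\<xi> - X' r))\<^sup>2 \<le> B" for r
    unfolding X'_def by (rule B) (use T0 in auto)
  \<comment> \<open>The Lipschitz constant for the Euclidean norm, after one norm comparison on each
    side.\<close>
  define L' where "L' = a * L * b"
  have lip: "norm (F x s - F y s) \<le> L' * norm (x - y)" if "s \<in> space S" for x y s
  proof -
    have "norm (F x s - F y s) \<le> a * \<nu> (F x s - F y s)" by (rule ab)
    also have "\<dots> \<le> a * (L * \<nu> (x - y))"
      using assms(7)[OF that, of x y] ab(1) by (intro mult_left_mono) auto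
    also have "\<dots> \<le> a * (L * (b * norm (x - y)))"
      using ab(1) assms(3) by (intro mult_left_mono ab) auto
    finally show ?thesis by (simp add: L'_def ac_simps)
  qed
  have F_sec [measurable]: "F x \<in> borel_measurable \<mu>" for x
    using measurable_compose[OF measurable_Pair1' F_meas] by (simp add: measurable_cong_sets[OF sets_\<mu> refl])
  have F_pair [measurable]: "(\<lambda>q. F (X' (snd q * t)) (fst q)) \<in> borel_measurable (\<mu> \<Otimes>\<^sub>M unif)" for t
  proof -
    have "(\<lambda>q. case_prod F (X' (snd q * t), fst q)) \<in> borel_measurable (\<mu> \<Otimes>\<^sub>M unif)" by measurable
    then show ?thesis by simp
  qed
  have F2: "integrable \<mu> (\<lambda>s. (norm (F \<xi> s))\<^sup>2)"
  proof -
    have "integrable M (\<lambda>\<omega>. (norm (F \<xi> (Z [0] \<omega>)))\<^sup>2)"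
    proof (rule Bochner_Integration.integrable_bound[OF integrable_mult_right[OF assms(11), of "a\<^sup>2"]])
      have "(\<lambda>\<omega>. case_prod F (\<xi>, Z [0] \<omega>)) \<in> borel_measurable M" by measurable
      then show "(\<lambda>\<omega>. (norm (F \<xi> (Z [0] \<omega>)))\<^sup>2) \<in> borel_measurable M" by simp
      show "AE \<omega> in M. norm ((norm (F \<xi> (Z [0] \<omega>)))\<^sup>2) \<le> norm (a\<^sup>2 * (\<nu> (F \<xi> (Z [0] \<omega>)))\<^sup>2)"
        using ab(3) by (auto intro!: power_mono simp flip: power_mult_distrib)
    qed
    then show ?thesis
      unfolding \<mu>_def by (subst integrable_distr_eq) (use F_sec in \<open>auto simp: \<mu>_def\<close>)
  qed
  have X'_int: "X' t = \<xi> + t *\<^sub>R (\<integral>q. F (X' (snd q * t)) (fst q) \<partial>(\<mu> \<Otimes>\<^sub>M unif))" if t: "t \<in> {0..T}" for t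
  proof -
    define f where "f r = (\<integral>s. F (X' r) s \<partial>\<mu>)" for r
    have [measurable]: "f \<in> borel_measurable borel"
    proof -
      have "(\<lambda>p. case_prod F (X' (fst p), snd p)) \<in> borel_measurable (borel \<Otimes>\<^sub>M \<mu>)" by measurable
      then have "(\<lambda>(r, s). F (X' r) s) \<in> borel_measurable (borel \<Otimes>\<^sub>M \<mu>)" by (simp add: split_beta')
      then show ?thesis unfolding f_def by (rule \<mu>.borel_measurable_lebesgue_integral)
    qed
    have "X t = \<xi> + (LINT r:{0..t}|lborel. f r)"
    proof -
      have "(LINT r:{0..t}|lborel. (LINT \<omega>|M. F (X r) (Z [0] \<omega>))) = (LINT r:{0..t}|lborel. f r)"
        using t F_sec unfolding f_def \<mu>_def
        by (intro set_lebesgue_integral_cong) (auto simp: integral_distr X'_eq)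
      then show ?thesis using assms(12)[OF t] by simp
    qed
    also have "(LINT r:{0..t}|lborel. f r) = t *\<^sub>R (\<integral>r. f (r * t) \<partial>unif)"
    proof (cases "t = 0")
      case True
      have "AE r in lborel. indicator {0..t} r *\<^sub>R f r = 0"
        using AE_lborel_singleton[of "0::real"] by eventually_elim (simp add: True indicator_def)
      then have "(LINT r:{0..t}|lborel. f r) = 0"
        unfolding set_lebesgue_integral_def by (rule integral_eq_zero_AE)
      then show ?thesis using True by simp
    next
      case False
      then show ?thesis using t by (subst scaleR_integral_unif) auto
    qed
    also have "(\<integral>r. f (r * t) \<partial>unif) = (\<integral>q. F (X' (snd q * t)) (fst q) \<partial>(\<mu> \<Otimes>\<^sub>M unif))"
    proof -
      \<comment> \<open>An integrable majorant for Fubini: the Lipschitz condition compares with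
        \<open>F \<xi>\<close>, and a norm is at most 1 plus its square, which \<open>B\<close>
        bounds.\<close>
      let ?C = "\<lambda>q :: 's \<times> real. norm (F \<xi> (fst q)) + L' * (1 + B)"
      have "integrable \<mu> (\<lambda>s. norm (F \<xi> s))"
        by (rule \<mu>.square_integrable_imp_integrable) (use F2 in auto)
      then have "integrable (distr (\<mu> \<Otimes>\<^sub>M unif) \<mu> fst) (\<lambda>s. norm (F \<xi> s))"
        by (simp add: U.distr_pair_fst)
      then have "integrable (\<mu> \<Otimes>\<^sub>M unif) (\<lambda>q. norm (F \<xi> (fst q)))"
        by (subst (asm) integrable_distr_eq) auto
      then have intC: "integrable (\<mu> \<Otimes>\<^sub>M unif) ?C" by simp
      have L'0: "L' \<ge> 0" using ab assms(3) by (simp add: L'_def)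
      have "integrable (\<mu> \<Otimes>\<^sub>M unif) (\<lambda>q. F (X' (snd q * t)) (fst q))"
      proof (rule Bochner_Integration.integrable_bound[OF intC])
        have "norm (F (X' (snd q * t)) (fst q)) \<le> norm (?C q)" if "q \<in> space (\<mu> \<Otimes>\<^sub>M unif)" for q
        proof -
          let ?x = "X' (snd q * t)"
          have "fst q \<in> space S" using that by (auto simp: space_pair_measure space_\<mu>)
          from lip[OF this, of ?x \<xi>]
          have "norm (F ?x (fst q)) \<le> norm (F \<xi> (fst q)) + L' * norm (?x - \<xi>)"
            using norm_triangle_sub[of "F ?x (fst q)" "F \<xi> (fst q)"] by linarith
          moreover have "norm (?x - \<xi>) \<le> 1 + (norm (\<xi> - ?x))\<^sup>2"
            using sum_squares_bound[of 1 "norm (\<xi> - ?x)"] norm_ge_zero[of "\<xi> - ?x"]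
            unfolding norm_minus_commute[of ?x \<xi>] one_power2 by linarith
          then have "norm (?x - \<xi>) \<le> 1 + B" using B'[of "snd q * t"] by linarith
          then have "L' * norm (?x - \<xi>) \<le> L' * (1 + B)" using L'0 by (rule mult_left_mono)
          ultimately show ?thesis by simp
        qed
        then show "AE q in \<mu> \<Otimes>\<^sub>M unif. norm (F (X' (snd q * t)) (fst q)) \<le> norm (?C q)" by (intro AE_I2)
      qed measurable
      then have "integrable (\<mu> \<Otimes>\<^sub>M unif) (\<lambda>(s, r). F (X' (r * t)) s)" by (simp add: split_beta')
      from \<mu>U.integral_snd[OF this] show ?thesis by (simp add: f_def split_beta')
    qed
    finally show ?thesis using t by (simp add: X'_eq)
  qed
  have mlp: "mlp_setting \<mu> F \<xi> X' T L' m" if "m \<ge> 1" for m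
    using that T0 F2 X'_cont X'_int lip ab assms(3) \<mu>.prob_space_axioms
    by unfold_locales (auto simp: space_\<mu> L'_def)
  let ?Q = "\<mu> \<Otimes>\<^sub>M unif" and ?P = "PiM Theta (\<lambda>_. \<mu> \<Otimes>\<^sub>M unif)"
  define W where "W \<omega> = (\<lambda>\<eta>\<in>Theta. (Z \<eta> \<omega>, \<rr> \<eta> \<omega>))" for \<omega>
  have sets_Q: "sets ?Q = sets (S \<Otimes>\<^sub>M borel)"
    by (rule sets_pair_measure_cong) (simp_all add: sets_\<mu>)
  have sets_P: "sets ?P = sets (PiM Theta (\<lambda>_. S \<Otimes>\<^sub>M borel))"
    by (intro sets_PiM_cong refl sets_Q)
  have W_meas: "W \<in> M \<rightarrow>\<^sub>M ?P"
    unfolding W_def measurable_cong_sets[OF refl sets_P]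
    by (intro measurable_restrict measurable_Pair rvZ rvr)
  have "distr M (PiM Theta (\<lambda>_. S \<Otimes>\<^sub>M borel)) W = ?P"
    unfolding W_def
  proof (rule M.distr_Pair_PiM[OF assms(9,14,16)])
    show "distr M S (Z \<theta>) = \<mu>" if "\<theta> \<in> Theta" for \<theta>
      unfolding \<mu>_def by (rule assms(10)[OF that])
    show "distr M borel (\<rr> \<theta>) = unif" if "\<theta> \<in> Theta" for \<theta>
      by (rule assms(15)[OF that])
    show "Theta \<noteq> {}" by (auto simp: Theta_def intro: exI[of _ "[0]"])
  qed
  then have W_distr: "distr M ?P W = ?P"
    using distr_cong[OF refl sets_P, of M W W] by simp
  have sh_meas: "subfamily [0] \<in> ?P \<rightarrow>\<^sub>M ?P"
    by (rule measurable_subfamily) (simp add: Theta_def)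
  \<comment> \<open>The approximation with index \<open>[0]\<close> reads only proper descendants of
    \<open>[0]\<close>; relabelled, they have the same law as the whole family.\<close>
  define W0 where "W0 \<omega> = subfamily [0] (W \<omega>)" for \<omega>
  have W0_meas: "W0 \<in> M \<rightarrow>\<^sub>M ?P"
    unfolding W0_def using measurable_compose[OF W_meas sh_meas] .
  have W0_distr: "distr M ?P W0 = ?P"
  proof -
    have "distr M ?P W0 = distr (distr M ?P W) ?P (subfamily [0])"
      unfolding W0_def by (subst distr_distr[OF sh_meas W_meas]) (simp add: comp_def)
    then show ?thesis
      using W_distr distr_subfamily[of ?Q "[0]"] \<mu>U.P.prob_space_axioms by simp
  qed
  have Y_eq: "Y [0] n m t \<omega> = mlp F \<xi> m n t (W0 \<omega>)" if "m \<ge> 1" "t \<in> {0..T}" "\<omega> \<in> space M" for n m t \<omega>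
  proof -
    have "W0 \<omega> = subfamily [0] (\<lambda>\<eta>. (Z \<eta> \<omega>, \<rr> \<eta> \<omega>))"
      by (auto simp: W0_def W_def subfamily_def Theta_def)
    then show ?thesis
      using mlp_unique[of \<rr> \<omega> T Y m F Z \<xi> "[0]" t n] that r01 assms(17) by (simp add: Theta_def)
  qed
  define \<kappa> where "\<kappa> = 7 * T * L'\<^sup>2 + 1"
  define C where "C = (\<integral>s. (norm (F \<xi> s))\<^sup>2 \<partial>\<mu>)"
  \<comment> \<open>Besides the two bounds for the induction, the 1 makes \<open>D\<close> positive,
    as the choice of the level requires.\<close>
  define D where "D = max 1 (max (T\<^sup>2 * C) B)"
  \<comment> \<open>Chosen so that \<open>2 ^ m / m ^ m * exp (\<kappa> * m * T)\<close> is
    \<open>(\<beta> / m) ^ m\<close>.\<close>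
  define \<beta> where "\<beta> = 2 * exp (\<kappa> * T)"
  have err: "integrable M (\<lambda>\<omega>. (\<nu> (X T - Y [0] m m T \<omega>))\<^sup>2) \<and>
      (LINT \<omega>|M. (\<nu> (X T - Y [0] m m T \<omega>))\<^sup>2) \<le> b\<^sup>2 * D * (\<beta> / real m) ^ m" if m: "m \<ge> 1" for m
  proof -
    interpret mlp_setting \<mu> F \<xi> X' T L' m by (rule mlp[OF m])
    have P: "P = ?P" by (simp add: P_def Q_def)
    have "err_le m (D * 2 ^ m / real m ^ m) (\<kappa> * real m)"
      unfolding \<kappa>_def
    proof (rule mlp_error)
      show "T\<^sup>2 * K \<le> D"
        by (simp add: K_def C_def D_def)
      show "(norm (\<xi> - X' t))\<^sup>2 \<le> D" for t using B'[of t] by (simp add: D_def)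
    qed
    then have e: "integrable P (err m T)" "(\<integral>w. err m T w \<partial>P) \<le> D * 2 ^ m / real m ^ m * exp (\<kappa> * real m * T)"
      using T0 by (auto simp: err_le_def)
    have err_meas: "err m T \<in> borel_measurable ?P" using e(1) P by auto
    have int: "integrable M (\<lambda>\<omega>. err m T (W0 \<omega>))"
      using e(1) integrable_distr_eq[OF W0_meas err_meas] W0_distr P by simp
    have eq: "(LINT \<omega>|M. err m T (W0 \<omega>)) = (\<integral>w. err m T w \<partial>P)"
      using integral_distr[OF W0_meas err_meas] W0_distr P by simp
    have le: "(\<nu> (X T - Y [0] m m T \<omega>))\<^sup>2 \<le> b\<^sup>2 * err m T (W0 \<omega>)" if "\<omega> \<in> space M" for \<omega>
    proof -
      have "(\<nu> (X T - Y [0] m m T \<omega>))\<^sup>2 \<le> (b * norm (X T - Y [0] m m T \<omega>))\<^sup>2"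
        by (intro power_mono ab \<nu>0)
      also have "\<dots> = b\<^sup>2 * err m T (W0 \<omega>)"
        using Y_eq[OF m _ that] T0 by (simp add: err_def power_mult_distrib X'_eq norm_minus_commute)
      finally show ?thesis .
    qed
    have meas: "(\<lambda>\<omega>. (\<nu> (X T - Y [0] m m T \<omega>))\<^sup>2) \<in> borel_measurable M"
    proof -
      have "(\<lambda>\<omega>. mlp F \<xi> m m T (W0 \<omega>)) \<in> borel_measurable M"
        using measurable_compose[OF W0_meas] measurable_\<Phi>_P[of m T] P by simp
      then have "(\<lambda>\<omega>. (\<nu> (X T - mlp F \<xi> m m T (W0 \<omega>)))\<^sup>2) \<in> borel_measurable M" by measurable
      then show ?thesis
        by (rule measurable_cong[THEN iffD1, rotated]) (use Y_eq[OF m] T0 in auto)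
    qed
    have int2: "integrable M (\<lambda>\<omega>. (\<nu> (X T - Y [0] m m T \<omega>))\<^sup>2)"
      using le by (intro Bochner_Integration.integrable_bound[OF integrable_mult_right[OF int, of "b\<^sup>2"] meas])
        (auto intro!: AE_I2 abs_ge_self[THEN order_trans[rotated]])
    have "(LINT \<omega>|M. (\<nu> (X T - Y [0] m m T \<omega>))\<^sup>2) \<le> (LINT \<omega>|M. b\<^sup>2 * err m T (W0 \<omega>))"
      by (intro integral_mono int2 integrable_mult_right int le)
    also have "\<dots> \<le> b\<^sup>2 * (D * 2 ^ m / real m ^ m * exp (\<kappa> * real m * T))"
      unfolding integral_mult_right_zero eq by (rule mult_left_mono[OF e(2)]) simp
    also have "exp (\<kappa> * real m * T) = exp (\<kappa> * T) ^ m"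
      by (simp flip: exp_of_nat_mult add: ac_simps)
    also have "b\<^sup>2 * (D * 2 ^ m / real m ^ m * exp (\<kappa> * T) ^ m) = b\<^sup>2 * D * (\<beta> / real m) ^ m"
      by (simp add: \<beta>_def power_divide power_mult_distrib)
    finally show ?thesis using int2 by simp
  qed
  have D_pos: "b\<^sup>2 * D > 0" using ab by (auto simp: D_def)
  obtain c N where cN: "\<forall>\<epsilon>\<in>{0<..1}. N \<epsilon> \<ge> 1 \<and> (5 * real (N \<epsilon>)) ^ N \<epsilon> \<le> c * \<epsilon> powr (- (2 + \<delta>)) \<and>
      b\<^sup>2 * D * (\<beta> / real (N \<epsilon>)) ^ N \<epsilon> \<le> \<epsilon>\<^sup>2"
    using exists_level_error_cost[OF D_pos _ assms(1), of \<beta>] unfolding \<beta>_def by auto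
  show ?thesis
  proof (intro exI ballI conjI)
    fix \<epsilon> :: real assume \<epsilon>: "\<epsilon> \<in> {0<..1}"
    note N = cN[rule_format, OF \<epsilon>]
    then show N1: "N \<epsilon> \<ge> 1" by simp
    have "RV (N \<epsilon>) (N \<epsilon>) \<le> (5 * N \<epsilon>) ^ N \<epsilon>"
      by (rule RV_le_power) (use N1 assms(19,20) in auto)
    then have "real (RV (N \<epsilon>) (N \<epsilon>)) \<le> real ((5 * N \<epsilon>) ^ N \<epsilon>)" by (rule of_nat_mono)
    also have "\<dots> \<le> c * \<epsilon> powr (- (2 + \<delta>))" using N by simp
    finally show "real (RV (N \<epsilon>) (N \<epsilon>)) \<le> c * \<epsilon> powr (- (2 + \<delta>))" .
    show "integrable M (\<lambda>\<omega>. (\<nu> (X T - Y [0] (N \<epsilon>) (N \<epsilon>) T \<omega>))\<^sup>2)"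
      using err[OF N1] by simp
    have "(LINT \<omega>|M. (\<nu> (X T - Y [0] (N \<epsilon>) (N \<epsilon>) T \<omega>))\<^sup>2) \<le> \<epsilon>\<^sup>2"
      using err[OF N1] N by linarith
    then show "sqrt (LINT \<omega>|M. (\<nu> (X T - Y [0] (N \<epsilon>) (N \<epsilon>) T \<omega>))\<^sup>2) \<le> \<epsilon>"
      using \<epsilon> by (intro real_le_lsqrt) auto
  qed
qed

end
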